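(* There exist absolute constants $C,c>0$ such that for every integer $n\ge 3$, $$\mathrm{Fav}(\mathcal G_n)\le C\,e^{-c\sqrt{\log\log n}}.$$
   Context: Let $v_1,v_2,v_3\in\mathbb R^2$ be the vertices of a fixed equilateral triangle $T_0$ (closed, filled), and let $f_j(x)=v_j+\tfrac13(x-v_j)$, $j=1,2,3$. The one-dimensional Sierpinski gasket is the compact set $\mathcal G$ with $\mathcal G=\bigcup_{j=1}^3 f_j(\mathcal G)$; its convex hull is $T_0$. The $n$-th partially constructed gasket is $$\mathcal G_n=\bigcup_{(j_1,\dots,j_n)\in\{1,2,3\}^n} f_{j_1}\circ\cdots\circ f_{j_n}(T_0),$$ a union of $3^n$ triangles of side $3^{-n}$ times the side of $T_0$. For a set $E\subset\mathbb R^2$, the Favard length is $$\mathrm{Fav}(E)=\frac1\pi\int_0^\pi |\mathrm{proj}_\theta(E)|\,d\theta,$$ where $\mathrm{proj}_\theta$ is orthogonal projection onto the line through the origin in direction $\theta$ and $|\cdot|$ is Lebesgue measure on that line. *)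

theory Defs
  imports "HOL-Analysis.Analysis"
begin

(* The vertices v_1, v_2, v_3 are indexed by the three-element numeral type 3. *)
definition equilateral :: "(3 \<Rightarrow> real ^ 2) \<Rightarrow> bool" where
  "equilateral v \<longleftrightarrow> (\<exists>s>0. \<forall>i j. i \<noteq> j \<longrightarrow> dist (v i) (v j) = s)"

definition contraction :: "(3 \<Rightarrow> real ^ 2) \<Rightarrow> 3 \<Rightarrow> real ^ 2 \<Rightarrow> real ^ 2" where
  "contraction v j x = v j + (1 / 3) *\<^sub>R (x - v j)"

(* For js = [j_1, ..., j_n] this is the composition f_{j_1} o ... o f_{j_n}. *)
definition word_map :: "(3 \<Rightarrow> real ^ 2) \<Rightarrow> 3 list \<Rightarrow> real ^ 2 \<Rightarrow> real ^ 2" where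
  "word_map v js = foldr (\<lambda>j g. contraction v j \<circ> g) js id"

definition gasket_approx :: "(3 \<Rightarrow> real ^ 2) \<Rightarrow> nat \<Rightarrow> (real ^ 2) set" where
  "gasket_approx v n = (\<Union>js\<in>{js. length js = n}. word_map v js ` (convex hull (range v)))"

definition direction :: "real \<Rightarrow> real ^ 2" where
  "direction \<theta> = vector [cos \<theta>, sin \<theta>]"

definition line_proj :: "real \<Rightarrow> real ^ 2 \<Rightarrow> real ^ 2" where
  "line_proj \<theta> x = (x \<bullet> direction \<theta>) *\<^sub>R direction \<theta>"

(* Lebesgue measure on the line through the origin in direction theta, transported
   from the reals along the isometry t \<mapsto> t * direction theta. *)
definition line_measure :: "real \<Rightarrow> (real ^ 2) set \<Rightarrow> ennreal" where
  "line_measure \<theta> A = emeasure lebesgue {t. t *\<^sub>R direction \<theta> \<in> A}"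

(* Valued in ennreal, so that neither an infinite measure nor a divergent integral
   is silently replaced by 0. *)
definition favard_length :: "(real ^ 2) set \<Rightarrow> ennreal" where
  "favard_length E =
     ennreal (1 / pi) * (\<integral>\<^sup>+\<theta>\<in>{0..pi}. line_measure \<theta> (line_proj \<theta> ` E) \<partial>lborel)"

end

theory Submission
  imports Defs
begin

text \<open>
  Fix a direction and write the projections of the three vertices, after an affine change of the
  line, as digits $0, t, 1$ with $0 \le t \le 1$. The projection of the $n$-th approximation becomes
  the union of the intervals of length $\frac32 3^{-n}$ that start at the digit sums
  $\sum_{k<n} 3^{-k} d_k$. The measure of this union is small as soon as the intervals overlap a lot
  at some earlier level, so the proof looks for overlaps.

  Overlap decays the measure (\<open>stack_decay\<close>). Call $K$ words of a common length $l$ a stack if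
  their digit sums lie in one interval of length $3^{-l}$. By self-similarity level $l(r+1)$ is a
  union of $3^l$ translates of level $lr$ scaled by $3^{-l}$, and the $K$ copies that belong to the
  stack share an interval of length $O(3^{-l})$. So the measure at level $l(r+1)$ is at most
  $(1 - K 3^{-l})$ times that at level $lr$ plus $O(3^{-l})$, and iterating $3^l$ times leaves a
  measure $O(1/K)$.

  Without overlap a Fourier integral is too small (\<open>number_of_windows_le_if_no_stack\<close>). The
  exponential sum over all words of length $n$ is a product of factors
  $\Phi(\xi / 3^k)$ with $3\,\Phi(\xi) = 1 + e^{i\xi} + e^{it\xi}$. If there is no stack of
  more than $K$ words up to level $N$, then $\int_0^{3^N} \prod_{k<N} |\Phi(\xi/3^k)|^2 \, d\xi = O(K)$,
  by a large-sieve estimate with a Fejer weight (\<open>energy_upper\<close>). Conversely, cut the frequencies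
  into $R$ windows $[3^{rm}, 3^{(r+1)m}]$, with $3^m$ a large multiple of $K$. Over such a
  window the factors with $k < rm$ have an integral of order at least $3^m$, because the diagonal
  terms alone contribute that much (\<open>energy_lower\<close>); the next $m+1$ factors are at least
  $d^2$ each if $|\Phi| \ge d$ on $[0, 3^m]$; the product of the remaining ones is bounded below.
  Hence $R\, d^{2m+2} 3^m = O(K)$, and a larger $R$ forces a stack.

  Small factors are rare (\<open>emeasure_resonant_le\<close>). If $|\Phi(y)| < d$, the three unit vectors
  nearly cancel, so both $3y/2\pi$ and $3ty/2\pi$ are within $O(d)$ of integers $a \ge 1$ and $b$,
  and $|ta - b| = O(d)$. In terms of the direction, this says that one of the vectors
  $a (v_k - v_i) - b (v_j - v_i)$, whose length is comparable to $a$, is almost orthogonal to it. For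
  $a \le 3^m$ the directions where this happens have total measure $O(3^m d)$.

  Take $K = 3^q$, $m = q + 5$ and $d = 3^{-(2q+5)}$. Outside a set of directions of measure
  $O(3^{-q})$, there is a stack at some level $l \le N$ with $N = e^{O((q+1)^2)}$, and the
  projection has measure $O(3^{-q})$ once $n \ge N 3^N$. Choosing $q$ of order $\sqrt{\log \log n}$ gives the theorem.
\<close>

section \<open>Mean squares of exponential sums\<close>

text \<open>
  The cosine transform of a triangular weight. It is nonnegative, so diagonal terms bound a weighted
  energy from below, and it decays quadratically, so points in sparse position interact little.
\<close>
definition fejer :: "real \<Rightarrow> real \<Rightarrow> real" where
  "fejer L x = integral {0..L} (\<lambda>h. (1 - h / L) * cos (h * x))"

lemma fejer_zero: "L > 0 \<Longrightarrow> fejer L 0 = L / 2"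
proof -
  assume L: "L > 0"
  have "((\<lambda>h. (1 - h / L)) has_integral ((L - L^2/(2*L)) - (0 - 0^2/(2*L)))) {0..L}"
    by (rule fundamental_theorem_of_calculus)
       (use L in \<open>auto intro!: derivative_eq_intros simp flip: has_real_derivative_iff_has_vector_derivative simp: field_simps\<close>)
  then show ?thesis unfolding fejer_def using L
    by (subst integral_unique) (auto simp: power2_eq_square)
qed

lemma fejer_nonzero:
  assumes L: "L > 0" and x: "x \<noteq> 0"
  shows "fejer L x = (1 - cos (L * x)) / (L * x^2)"
proof -
  let ?G = "\<lambda>h. (1 - h / L) * sin (h * x) / x - cos (h * x) / (L * x^2)"
  have "((\<lambda>h. (1 - h / L) * cos (h * x)) has_integral (?G L - ?G 0)) {0..L}"
  proof (rule fundamental_theorem_of_calculus)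
    fix h assume "h \<in> {0..L}"
    have "(?G has_real_derivative ((1 - h / L) * cos (h * x))) (at h within {0..L})"
      using L x by (auto intro!: derivative_eq_intros simp: field_simps power2_eq_square)
    then show "(?G has_vector_derivative ((1 - h / L) * cos (h * x))) (at h within {0..L})"
      by (simp add: has_real_derivative_iff_has_vector_derivative)
  qed (use L in auto)
  then show ?thesis unfolding fejer_def using L x
    by (simp add: integral_unique diff_divide_distrib)
qed

lemma fejer_nonneg: "L > 0 \<Longrightarrow> fejer L x \<ge> 0"
  by (cases "x = 0") (auto simp: fejer_zero fejer_nonzero)

lemma fejer_le_half:
  assumes L: "L > 0" shows "fejer L x \<le> L / 2"
proof (cases "x = 0")
  case False
  have "1 - cos (L * x) = 2 * (sin (L * x / 2))^2"
    using cos_double_sin[of "L * x / 2"] by simp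
  also have "\<dots> \<le> 2 * (L * x / 2)^2"
    using abs_sin_x_le_abs_x[of "L * x / 2"] by (intro mult_left_mono) (auto simp only: abs_le_square_iff)
  finally have "1 - cos (L * x) \<le> (L / 2) * (L * x^2)" by (simp add: power2_eq_square)
  then show ?thesis using L False by (simp add: fejer_nonzero pos_divide_le_eq)
qed (simp add: fejer_zero L)

lemma fejer_le_decay:
  assumes "L > 0" "x \<noteq> 0" shows "fejer L x \<le> 2 / (L * x^2)"
proof -
  have "1 - cos (L * x) \<le> 2" using cos_ge_minus_one[of "L * x"] by linarith
  then show ?thesis using assms by (simp add: fejer_nonzero divide_right_mono)
qed

text \<open>
  In the squared modulus the sine parts cancel in pairs, so only the even function $\cos$ of the
  differences remains and real integrals suffice.
\<close>
lemma norm_sum_cis_square: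
  fixes y :: "'w \<Rightarrow> real"
  shows "(cmod (\<Sum>w\<in>W. cis (\<xi> * y w)))^2 = (\<Sum>w\<in>W. \<Sum>u\<in>W. cos (\<xi> * (y w - y u)))"
  by (simp add: cmod_power2 power2_eq_square[of "sum _ _"] sum_product right_diff_distrib cos_diff sum.distrib)

text \<open>
  All off-diagonal terms are nonnegative once the integral carries the Fejer weight, which lies
  between 0 and 1; the diagonal alone gives the bound.
\<close>
lemma energy_lower:
  fixes y :: "'w \<Rightarrow> real"
  assumes "finite W" and A: "A > 0"
  shows "integral {0..A} (\<lambda>\<xi>. (cmod (\<Sum>w\<in>W. cis (\<xi> * y w)))^2) \<ge> real (card W) * A / 2"
proof -
  let ?f = "\<lambda>\<xi>. (cmod (\<Sum>w\<in>W. cis (\<xi> * y w)))^2"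
  have cf: "continuous_on {0..A} ?f" by (intro continuous_intros)
  have "real (card W) * A / 2 = (\<Sum>w\<in>W. fejer A (y w - y w))"
    by (simp add: fejer_zero A)
  also have "\<dots> \<le> (\<Sum>w\<in>W. \<Sum>u\<in>W. fejer A (y w - y u))"
    by (intro sum_mono member_le_sum) (auto simp: assms fejer_nonneg)
  also have "\<dots> = integral {0..A} (\<lambda>\<xi>. \<Sum>w\<in>W. \<Sum>u\<in>W. (1 - \<xi> / A) * cos (\<xi> * (y w - y u)))"
    unfolding fejer_def
    using A by (simp add: integral_sum assms(1) integrable_continuous_interval continuous_intros)
  also have "\<dots> = integral {0..A} (\<lambda>\<xi>. (1 - \<xi> / A) * ?f \<xi>)"
    by (simp add: norm_sum_cis_square sum_distrib_left)
  also have "\<dots> \<le> integral {0..A} ?f"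
  proof (intro integral_le integrable_continuous_interval cf continuous_intros)
    fix \<xi> assume "\<xi> \<in> {0..A}"
    then have "1 - \<xi> / A \<le> 1" using A by simp
    then show "(1 - \<xi> / A) * ?f \<xi> \<le> ?f \<xi>" by (intro mult_left_le_one_le) (use \<open>\<xi> \<in> {0..A}\<close> A in auto)
  qed (use A in auto)
  finally show ?thesis .
qed

lemma sum_inverse_squares_le: "(\<Sum>q=1..Suc Q. 1 / (real q)^2) \<le> 2 - 1 / real (Suc Q)"
proof (induction Q)
  case (Suc Q)
  define a where "a = real (Suc Q)"
  have a: "a > 0" by (simp add: a_def)
  have "1 / (a + 1)^2 \<le> 1 / (a * (a + 1))"
    using a by (intro divide_left_mono) (auto simp: power2_eq_square)
  also have "\<dots> = 1 / a - 1 / (a + 1)" using a by (simp add: field_simps)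
  finally have "1 / (a + 1)^2 \<le> 1 / a - 1 / (a + 1)" .
  moreover have "real (Suc (Suc Q)) = a + 1" by (simp add: a_def)
  ultimately show ?case using Suc unfolding a_def[symmetric] by (simp only: sum.cl_ivl_Suc) simp
qed simp

text \<open>
  Sorting the points by their distance to $z$ in units of $1/L$ puts at most $2K$ of them, one
  window on either side of $z$, in each class; the quadratic decay then makes the sum over the
  classes converge.
\<close>
lemma fejer_row_sum:
  fixes y :: "'w \<Rightarrow> real"
  assumes W: "finite W" and L: "L > 0"
    and K: "\<And>x. card {w \<in> W. x \<le> y w \<and> y w \<le> x + 1 / L} \<le> K"
  shows "(\<Sum>u\<in>W. fejer L (z - y u)) \<le> 9 * real K * L"
proof -
  \<comment> \<open>The distance class of a point, and the bound for \<open>fejer L\<close> on that class.\<close>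
  define q where "q u = nat \<lfloor>L * \<bar>z - y u\<bar>\<rfloor>" for u
  define b where "b n = (if n = 0 then L / 2 else 2 * L / (real n)^2)" for n :: nat
  define Q where "Q = Max (insert 0 (q ` W))"
  have qQ: "q u \<le> Q" if "u \<in> W" for u
    unfolding Q_def using that W by (intro Max_ge) auto
  have b0: "b n \<ge> 0" for n using L by (simp add: b_def)
  have qb: "real (q u) \<le> L * \<bar>z - y u\<bar>" "L * \<bar>z - y u\<bar> < real (q u) + 1" for u
    unfolding q_def using L by (auto simp: of_nat_nat)
  have le: "fejer L (z - y u) \<le> b (q u)" for u
  proof (cases "q u = 0")
    case True then show ?thesis using fejer_le_half[OF L, of "z - y u"] by (simp add: b_def)
  next
    case False
    then have ne: "z - y u \<noteq> 0" using qb(1)[of u] by auto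
    have "fejer L (z - y u) \<le> 2 / (L * (z - y u)^2)" by (rule fejer_le_decay[OF L ne])
    also have "\<dots> = 2 * L / (L * \<bar>z - y u\<bar>)^2" using L ne by (simp add: power_mult_distrib power2_eq_square)
    also have "\<dots> \<le> 2 * L / (real (q u))^2"
      using qb(1)[of u] False L by (intro divide_left_mono power_mono mult_pos_pos zero_less_power) auto
    finally show ?thesis using False by (simp add: b_def)
  qed
  have cnt: "card {u \<in> W. q u = n} \<le> 2 * K" for n
  proof -
    let ?S = "\<lambda>x. {w \<in> W. x \<le> y w \<and> y w \<le> x + 1 / L}"
    have "{u \<in> W. q u = n} \<subseteq> ?S (z - (real n + 1) / L) \<union> ?S (z + real n / L)"
    proof
      fix u assume u: "u \<in> {u \<in> W. q u = n}"
      then have "real n / L \<le> \<bar>z - y u\<bar>" "\<bar>z - y u\<bar> \<le> (real n + 1) / L"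
        using qb[of u] L by (auto simp: field_simps)
      then show "u \<in> ?S (z - (real n + 1) / L) \<union> ?S (z + real n / L)"
        using u by (auto simp: add_divide_distrib abs_if split: if_splits)
    qed
    then have "card {u \<in> W. q u = n} \<le> card (?S (z - (real n + 1) / L) \<union> ?S (z + real n / L))"
      using W by (intro card_mono) auto
    also have "\<dots> \<le> K + K" by (rule order_trans[OF card_Un_le add_mono[OF K K]])
    finally show ?thesis by simp
  qed
  have "(\<Sum>u\<in>W. fejer L (z - y u)) \<le> (\<Sum>u\<in>W. b (q u))" by (intro sum_mono le)
  also have "\<dots> = (\<Sum>n\<in>{..Q}. \<Sum>u\<in>{u \<in> W. q u = n}. b (q u))"
    by (rule sum.group[symmetric]) (use W qQ in auto)
  also have "\<dots> = (\<Sum>n\<in>{..Q}. real (card {u \<in> W. q u = n}) * b n)" by simp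
  also have "\<dots> \<le> (\<Sum>n\<in>{..Q}. (2 * real K) * b n)"
  proof (intro sum_mono mult_right_mono b0)
    fix n show "real (card {u \<in> W. q u = n}) \<le> 2 * real K" using cnt[of n] by linarith
  qed
  also have "\<dots> = 2 * real K * (b 0 + (\<Sum>n=1..Q. b n))"
    by (simp add: sum_distrib_left[symmetric] sum.atLeast1_atMost_eq sum.atMost_shift lessThan_atLeast0)
  also have "(\<Sum>n=1..Q. b n) = 2 * L * (\<Sum>n=1..Q. 1 / (real n)^2)"
    by (simp add: b_def sum_distrib_left)
  also have "2 * real K * (b 0 + 2 * L * (\<Sum>n=1..Q. 1 / (real n)^2)) \<le> 2 * real K * (L / 2 + 2 * L * 2)"
  proof -
    have "(\<Sum>n=1..Q. 1 / (real n)^2) \<le> 2"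
    proof (cases Q)
      case (Suc Q')
      have "0 \<le> 1 / real (Suc Q')" by simp
      then show ?thesis using sum_inverse_squares_le[of Q'] unfolding Suc by linarith
    qed simp
    then show ?thesis using L by (intro mult_left_mono add_mono) (auto simp: b_def)
  qed
  finally show ?thesis by (simp add: mult_ac)
qed

text \<open>
  A large-sieve inequality. The interval is the middle half of one of length $2L$, on which the
  triangular weight is at least $\frac12$; doubling the weight therefore dominates the integral.
  Folding the integral around the centre $d$ removes the odd part of the phase and leaves values of
  \<open>fejer L\<close>, up to factors of modulus at most 1.
\<close>
lemma energy_upper:
  fixes y :: "'w \<Rightarrow> real"
  assumes W: "finite W" and L: "L > 0"
    and K: "\<And>x. card {w \<in> W. x \<le> y w \<and> y w \<le> x + 1 / L} \<le> K"
  shows "integral {c..c+L} (\<lambda>\<xi>. (cmod (\<Sum>w\<in>W. cis (\<xi> * y w)))^2) \<le> 36 * real K * L * real (card W)"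
proof -
  let ?f = "\<lambda>\<xi>. (cmod (\<Sum>w\<in>W. cis (\<xi> * y w)))^2"
  define d where "d = c + L / 2"
  have cf: "continuous_on S ?f" for S by (intro continuous_intros)
  have cfp: "continuous_on S (\<lambda>h. ?f (d + h))" and cfm: "continuous_on S (\<lambda>h. ?f (d - h))" for S
    by (intro continuous_intros)+
  have "integral {c..c+L} ?f = integral {c..d} ?f + integral {d..c+L} ?f"
    by (intro Henstock_Kurzweil_Integration.integral_combine[symmetric] integrable_continuous_interval cf)
       (use L in \<open>auto simp: d_def\<close>)
  also have "integral {d..c+L} ?f = integral {0..L/2} (\<lambda>h. ?f (d + h))"
    using integral_shift_Icc_real[of 0 "L/2" ?f d] by (simp add: d_def o_def add_ac)
  also have "integral {c..d} ?f = integral {0..L/2} (\<lambda>h. ?f (d - h))"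
    using integral_shift_Icc_real[of "- (L/2)" 0 ?f d]
      Henstock_Kurzweil_Integration.integral_reflect_real[of "L/2" 0 "\<lambda>h. ?f (d - h)"]
    by (simp add: d_def o_def add_ac)
  also have "integral {0..L/2} (\<lambda>h. ?f (d - h)) + integral {0..L/2} (\<lambda>h. ?f (d + h))
     = integral {0..L/2} (\<lambda>h. ?f (d - h) + ?f (d + h))"
    by (intro Henstock_Kurzweil_Integration.integral_add[symmetric] integrable_continuous_interval cfp cfm)
  also have "\<dots> \<le> integral {0..L/2} (\<lambda>h. 2 * (1 - h / L) * (?f (d - h) + ?f (d + h)))"
  proof (intro integral_le integrable_continuous_interval continuous_intros cfp cfm)
    fix h assume h: "h \<in> {0..L/2}"
    then have "1 \<le> 2 * (1 - h / L)" using L by (simp add: field_simps)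
    then show "?f (d - h) + ?f (d + h) \<le> 2 * (1 - h / L) * (?f (d - h) + ?f (d + h))"
      using mult_right_mono[of 1 "2 * (1 - h / L)" "?f (d - h) + ?f (d + h)"] by simp
  qed (use L in auto)
  also have "\<dots> \<le> integral {0..L} (\<lambda>h. 2 * (1 - h / L) * (?f (d - h) + ?f (d + h)))"
  proof (rule integral_subset_le)
    have int: "(\<lambda>h. 2 * (1 - h / L) * (?f (d - h) + ?f (d + h))) integrable_on {0..b}" for b
      using L by (intro integrable_continuous_interval continuous_intros cfp cfm) auto
    show "(\<lambda>h. 2 * (1 - h / L) * (?f (d - h) + ?f (d + h))) integrable_on {0..L/2}"
      and "(\<lambda>h. 2 * (1 - h / L) * (?f (d - h) + ?f (d + h))) integrable_on {0..L}" by (rule int)+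
    show "\<forall>h\<in>{0..L}. 0 \<le> 2 * (1 - h / L) * (?f (d - h) + ?f (d + h))"
      using L by (intro ballI mult_nonneg_nonneg add_nonneg_nonneg zero_le_power2) (auto simp: field_simps)
  qed (use L in auto)
  also have "\<dots> = integral {0..L} (\<lambda>h. \<Sum>w\<in>W. \<Sum>u\<in>W. 4 * cos (d * (y w - y u)) * ((1 - h / L) * cos (h * (y w - y u))))"
  proof (intro integral_cong)
    fix h
    have "cos ((d - h) * x) + cos ((d + h) * x) = 2 * (cos (d * x) * cos (h * x))" for x
      by (simp add: cos_add cos_diff algebra_simps)
    then have "?f (d - h) + ?f (d + h) = (\<Sum>w\<in>W. \<Sum>u\<in>W. 2 * (cos (d * (y w - y u)) * cos (h * (y w - y u))))"
      by (simp only: norm_sum_cis_square sum.distrib[symmetric])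
    then show "2 * (1 - h / L) * (?f (d - h) + ?f (d + h)) =
       (\<Sum>w\<in>W. \<Sum>u\<in>W. 4 * cos (d * (y w - y u)) * ((1 - h / L) * cos (h * (y w - y u))))"
      by (simp only: sum_distrib_left) (intro sum.cong refl, simp add: algebra_simps)
  qed
  also have "\<dots> = (\<Sum>w\<in>W. \<Sum>u\<in>W. 4 * cos (d * (y w - y u)) * fejer L (y w - y u))"
    unfolding fejer_def
    using L by (simp add: integral_sum W integrable_continuous_interval continuous_intros)
  also have "\<dots> \<le> (\<Sum>w\<in>W. \<Sum>u\<in>W. 4 * fejer L (y w - y u))"
  proof (intro sum_mono mult_right_mono fejer_nonneg L)
    fix w u show "4 * cos (d * (y w - y u)) \<le> 4" using cos_le_one[of "d * (y w - y u)"] by linarith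
  qed
  also have "\<dots> = (\<Sum>w\<in>W. 4 * (\<Sum>u\<in>W. fejer L (y w - y u)))" by (simp add: sum_distrib_left)
  also have "\<dots> \<le> (\<Sum>w\<in>W. 4 * (9 * real K * L))"
    by (intro sum_mono mult_left_mono fejer_row_sum W L K) auto
  finally show ?thesis by (simp add: mult_ac)
qed

section \<open>Digit sums and the decay caused by a stack\<close>
definition words :: "nat \<Rightarrow> 3 list set" where
  "words n = {w. length w = n}"

fun digit_sum :: "(3 \<Rightarrow> real) \<Rightarrow> 3 list \<Rightarrow> real" where
  "digit_sum e [] = 0"
| "digit_sum e (a # w) = e a + digit_sum e w / 3"

text \<open>
  The projected approximation in normalised coordinates. The factor $\frac32 = \sum_k 3^{-k}$ is the
  length of the hull of all digit sums when the digits fill $[0, 1]$.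
\<close>
definition proj_approx :: "(3 \<Rightarrow> real) \<Rightarrow> nat \<Rightarrow> real set" where
  "proj_approx e n = (\<Union>w\<in>words n. {digit_sum e w .. digit_sum e w + 3 / 2 / 3 ^ n})"

text \<open>
  The characteristic function of a uniformly chosen digit. By independence of the digits, the
  characteristic function of a random digit sum is a product of rescaled copies of it.
\<close>
definition char_factor :: "(3 \<Rightarrow> real) \<Rightarrow> real \<Rightarrow> complex" where
  "char_factor e \<xi> = (\<Sum>a\<in>UNIV. cis (\<xi> * e a)) / 3"

lemma finite_words [simp]: "finite (words n)"
  using finite_lists_length_eq[of "UNIV :: 3 set" n] by (simp add: words_def)

lemma card_words: "card (words n) = 3 ^ n"
  using card_lists_length_eq[of "UNIV :: 3 set" n] by (simp add: words_def)

lemma words_0 [simp]: "words 0 = {[]}"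
  by (auto simp: words_def)

lemma words_Suc: "words (Suc n) = (\<lambda>(a, w). a # w) ` (UNIV \<times> words n)"
  by (auto simp: words_def length_Suc_conv image_iff)

lemma words_add: "words (l + n) = (\<lambda>(u, w). u @ w) ` (words l \<times> words n)"
proof (intro equalityI subsetI)
  fix w assume "w \<in> words (l + n)"
  then show "w \<in> (\<lambda>(u, w). u @ w) ` (words l \<times> words n)"
    by (intro image_eqI[where x = "(take l w, drop l w)"]) (auto simp: words_def)
qed (auto simp: words_def)

lemma digit_sum_append: "digit_sum e (u @ w) = digit_sum e u + digit_sum e w / 3 ^ length u"
  by (induction u) (auto simp: add_divide_distrib)

lemma digit_sum_bounds:
  assumes "\<And>a. 0 \<le> e a \<and> e a \<le> 1"
  shows "0 \<le> digit_sum e w \<and> digit_sum e w + 3 / 2 / 3 ^ length w \<le> 3 / 2"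
proof (induction w)
  case (Cons a w)
  then show ?case using assms[of a] by simp
qed simp

lemma sum_words_cis:
  "(\<Sum>w\<in>words n. cis (\<xi> * digit_sum e w)) = 3 ^ n * (\<Prod>k<n. char_factor e (\<xi> / 3 ^ k))"
proof (induction n arbitrary: \<xi>)
  case (Suc n)
  have "inj_on (\<lambda>(a, w). a # w) (UNIV \<times> words n)" by (auto simp: inj_on_def)
  then have "(\<Sum>w\<in>words (Suc n). cis (\<xi> * digit_sum e w))
      = (\<Sum>(a, w)\<in>UNIV \<times> words n. cis (\<xi> * e a) * cis (\<xi> / 3 * digit_sum e w))"
    unfolding words_Suc by (subst sum.reindex) (auto simp: cis_mult distrib_left intro!: sum.cong)
  also have "\<dots> = (\<Sum>a\<in>UNIV. cis (\<xi> * e a)) * (\<Sum>w\<in>words n. cis (\<xi> / 3 * digit_sum e w))"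
    by (simp add: sum_product sum.cartesian_product)
  also have "\<dots> = 3 * char_factor e \<xi> * (3 ^ n * (\<Prod>k<n. char_factor e (\<xi> / 3 ^ Suc k)))"
    using Suc[of "\<xi> / 3"] by (simp add: char_factor_def)
  also have "\<dots> = 3 ^ Suc n * (\<Prod>k<Suc n. char_factor e (\<xi> / 3 ^ k))"
    by (simp only: prod.lessThan_Suc_shift) simp
  finally show ?case .
qed simp

lemma proj_approx_0: "proj_approx e 0 = {0..3/2}"
  by (simp add: proj_approx_def)

lemma proj_approx_add:
  "proj_approx e (l + n) = (\<Union>u\<in>words l. (\<lambda>x. (1 / 3 ^ l) *\<^sub>R x + digit_sum e u) ` proj_approx e n)"
proof -
  have im: "(\<lambda>x. (1 / 3 ^ l) *\<^sub>R x + c) ` {d .. d + h} = {c + d / 3 ^ l .. c + d / 3 ^ l + h / 3 ^ l}" for c d h :: real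
  proof (intro equalityI subsetI)
    fix z assume z: "z \<in> {c + d / 3 ^ l .. c + d / 3 ^ l + h / 3 ^ l}"
    have "(z - c) * 3 ^ l \<in> {d .. d + h}"
      using z by (simp add: pos_divide_le_eq[symmetric] pos_le_divide_eq[symmetric] add_divide_distrib)
    then show "z \<in> (\<lambda>x. (1 / 3 ^ l) *\<^sub>R x + c) ` {d .. d + h}"
      by (intro image_eqI[where x = "(z - c) * 3 ^ l"]) auto
  next
    fix z assume "z \<in> (\<lambda>x. (1 / 3 ^ l) *\<^sub>R x + c) ` {d .. d + h}"
    then obtain r where r: "z = r / 3 ^ l + c" "d \<le> r" "r \<le> d + h" by auto
    have "d / 3 ^ l \<le> r / 3 ^ l" "r / 3 ^ l \<le> (d + h) / 3 ^ l"
      using r by (auto intro!: divide_right_mono)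
    then show "z \<in> {c + d / 3 ^ l .. c + d / 3 ^ l + h / 3 ^ l}"
      using r by (simp add: add_divide_distrib)
  qed
  have piece: "{digit_sum e (u @ w) .. digit_sum e (u @ w) + 3 / 2 / 3 ^ (l + n)}
      = (\<lambda>x. (1 / 3 ^ l) *\<^sub>R x + digit_sum e u) ` {digit_sum e w .. digit_sum e w + 3 / 2 / 3 ^ n}"
    if "u \<in> words l" for u w
    unfolding im using that by (simp add: digit_sum_append words_def power_add mult_ac)
  have "proj_approx e (l + n) = (\<Union>u\<in>words l. \<Union>w\<in>words n.
      {digit_sum e (u @ w) .. digit_sum e (u @ w) + 3 / 2 / 3 ^ (l + n)})"
    unfolding proj_approx_def words_add by auto
  also have "\<dots> = (\<Union>u\<in>words l. \<Union>w\<in>words n.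
      (\<lambda>x. (1 / 3 ^ l) *\<^sub>R x + digit_sum e u) ` {digit_sum e w .. digit_sum e w + 3 / 2 / 3 ^ n})"
    by (intro SUP_cong refl piece)
  finally show ?thesis unfolding proj_approx_def image_UN .
qed

lemma compact_proj_approx: "compact (proj_approx e n)"
  unfolding proj_approx_def by (rule compact_UN) auto

lemma proj_approx_measurable: "proj_approx e n \<in> lmeasurable"
  by (rule lmeasurable_compact[OF compact_proj_approx])

lemma proj_approx_antimono:
  assumes e: "\<And>a. 0 \<le> e a \<and> e a \<le> 1" and "m \<le> n"
  shows "proj_approx e n \<subseteq> proj_approx e m"
proof -
  obtain k where n: "n = m + k" using \<open>m \<le> n\<close> le_Suc_ex by blast
  have "proj_approx e k \<subseteq> proj_approx e 0"
  proof
    fix z assume "z \<in> proj_approx e k"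
    then obtain w where "length w = k" "digit_sum e w \<le> z" "z \<le> digit_sum e w + 3 / 2 / 3 ^ k"
      by (auto simp: proj_approx_def words_def)
    then show "z \<in> proj_approx e 0"
      using digit_sum_bounds[where e = e and w = w, OF e] by (auto simp: proj_approx_0)
  qed
  then show ?thesis
    unfolding n using proj_approx_add[of e m k] proj_approx_add[of e m 0] by auto
qed

lemma measure_proj_approx_le:
  assumes e: "\<And>a. 0 \<le> e a \<and> e a \<le> 1"
  shows "measure lebesgue (proj_approx e n) \<le> 3 / 2"
proof -
  have "measure lebesgue (proj_approx e n) \<le> measure lebesgue (proj_approx e 0)"
    by (rule measure_mono_fmeasurable[OF proj_approx_antimono[where e = e, OF e]
          fmeasurableD[OF proj_approx_measurable] proj_approx_measurable]) simp
  then show ?thesis by (simp add: proj_approx_0)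
qed

text \<open>
  The copies below words outside \<open>U\<close> are counted separately. All copies below words of \<open>U\<close> lie in a
  single interval: the starting points spread over $3^{-l}$ and each copy has length
  $\frac32 3^{-l}$.
\<close>
lemma stack_recursion:
  assumes e: "\<And>a. 0 \<le> e a \<and> e a \<le> 1"
    and U: "U = {w \<in> words l. x \<le> digit_sum e w \<and> digit_sum e w \<le> x + 1 / 3 ^ l}"
  shows "measure lebesgue (proj_approx e (l + n))
    \<le> (1 - real (card U) / 3 ^ l) * measure lebesgue (proj_approx e n) + 5 / 2 / 3 ^ l"
proof -
  let ?T = "\<lambda>u. (\<lambda>x. (1 / 3 ^ l) *\<^sub>R x + digit_sum e u) ` proj_approx e n"
  have mT: "measure lebesgue (?T u) = measure lebesgue (proj_approx e n) / 3 ^ l" for u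
    unfolding measure_lebesgue_affine by simp
  have T: "?T u \<in> lmeasurable" for u
    by (rule lmeasurable_compact[OF compact_continuous_image[OF _ compact_proj_approx]])
       (intro continuous_intros)
  have TU: "(\<Union>u\<in>words l - U. ?T u) \<in> lmeasurable"
    by (rule fmeasurable.finite_UN[OF finite_Diff[OF finite_words] T])
  have Uw: "U \<subseteq> words l" by (auto simp: U)
  have p32: "proj_approx e n \<subseteq> {0..3/2}"
    using proj_approx_antimono[where e = e, OF e, of 0 n] by (simp add: proj_approx_0)
  have sub: "proj_approx e (l + n) \<subseteq> (\<Union>u\<in>words l - U. ?T u) \<union> {x .. x + 5 / 2 / 3 ^ l}"
  proof
    fix z assume "z \<in> proj_approx e (l + n)"
    then obtain u where u: "u \<in> words l" "z \<in> ?T u" unfolding proj_approx_add by blast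
    show "z \<in> (\<Union>u\<in>words l - U. ?T u) \<union> {x .. x + 5 / 2 / 3 ^ l}"
    proof (cases "u \<in> U")
      case True
      obtain r where r: "r \<in> proj_approx e n" "z = r / 3 ^ l + digit_sum e u" using u(2) by auto
      have "0 \<le> r / 3 ^ l" "r / 3 ^ l \<le> (3/2) / 3 ^ l"
        using r(1) p32 by (auto intro!: divide_right_mono simp del: divide_divide_eq_left)
      moreover have "x \<le> digit_sum e u" "digit_sum e u \<le> x + 1 / 3 ^ l" using True by (auto simp: U)
      moreover have "5 / 2 / 3 ^ l = (3/2) / 3 ^ l + 1 / (3::real) ^ l" by (simp add: field_simps)
      ultimately show ?thesis unfolding r by auto
    qed (use u in blast)
  qed
  have "measure lebesgue (proj_approx e (l + n)) \<le> measure lebesgue ((\<Union>u\<in>words l - U. ?T u) \<union> {x .. x + 5 / 2 / 3 ^ l})"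
    by (rule measure_mono_fmeasurable[OF sub fmeasurableD[OF proj_approx_measurable] fmeasurable.Un[OF TU]]) simp
  also have "\<dots> \<le> measure lebesgue (\<Union>u\<in>words l - U. ?T u) + measure lebesgue {x .. x + 5 / 2 / 3 ^ l}"
    by (rule measure_Un_le[OF fmeasurableD[OF TU]]) simp
  also have "measure lebesgue (\<Union>u\<in>words l - U. ?T u) \<le> (\<Sum>u\<in>words l - U. measure lebesgue (?T u))"
    by (rule measure_UNION_le[OF finite_Diff[OF finite_words] fmeasurableD[OF T]])
  also have "\<dots> = real (card (words l - U)) * (measure lebesgue (proj_approx e n) / 3 ^ l)"
    unfolding mT by simp
  also have "real (card (words l - U)) = 3 ^ l - real (card U)"
    using Uw card_mono[OF finite_words Uw] by (subst card_Diff_subset) (auto intro: finite_subset simp: card_words of_nat_diff)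
  finally show ?thesis by (simp add: field_simps)
qed

text \<open>
  The recursion $a' \le (1 - K 3^{-l}) a + \frac52 3^{-l}$ has the fixed point $\frac52 / K$ and
  contracts towards it.
\<close>
lemma stack_decay:
  assumes e: "\<And>a. 0 \<le> e a \<and> e a \<le> 1" and K: "(K::nat) > 0"
    and U: "card {w \<in> words l. x \<le> digit_sum e w \<and> digit_sum e w \<le> x + 1 / 3 ^ l} \<ge> K"
  shows "measure lebesgue (proj_approx e (l * M)) \<le> 5 / 2 / real K + 3 / 2 * (1 - real K / 3 ^ l) ^ M"
proof (induction M)
  case 0 then show ?case using measure_proj_approx_le[where e = e, OF e, of 0] by (simp add: add_increasing)
next
  case (Suc M)
  define U where "U = {w \<in> words l. x \<le> digit_sum e w \<and> digit_sum e w \<le> x + 1 / 3 ^ l}"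
  have "card U \<le> card (words l)" by (intro card_mono) (auto simp: U_def)
  then have "card U \<le> 3 ^ l" by (simp add: card_words)
  with U have "real K \<le> real (3 ^ l)" unfolding U_def[symmetric] of_nat_le_iff by linarith
  then have q: "0 \<le> 1 - real K / 3 ^ l" by simp
  let ?a = "\<lambda>n. measure lebesgue (proj_approx e n)"
  have "?a (l * Suc M) \<le> (1 - real (card U) / 3 ^ l) * ?a (l * M) + 5 / 2 / 3 ^ l"
    using stack_recursion[where e = e, OF e U_def, of "l * M"] by simp
  also have "\<dots> \<le> (1 - real K / 3 ^ l) * ?a (l * M) + 5 / 2 / 3 ^ l"
    using U unfolding U_def[symmetric] by (intro add_right_mono mult_right_mono diff_left_mono divide_right_mono) auto
  also have "\<dots> \<le> (1 - real K / 3 ^ l) * (5 / 2 / real K + 3 / 2 * (1 - real K / 3 ^ l) ^ M) + 5 / 2 / 3 ^ l"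
    by (intro add_right_mono mult_left_mono Suc q)
  also have "\<dots> = 5 / 2 / real K + 3 / 2 * (1 - real K / 3 ^ l) ^ Suc M"
  proof -
    have "(1 - real K / 3 ^ l) * (5 / 2 / real K) = 5 / 2 / real K - 5 / 2 / 3 ^ l"
      using K by (simp add: field_simps)
    then show ?thesis by (simp only: distrib_left power_Suc) (simp add: mult_ac)
  qed
  finally show ?case .
qed

section \<open>Windows of frequencies\<close>
lemma continuous_on_char_factor [continuous_intros]:
  "continuous_on S f \<Longrightarrow> continuous_on S (\<lambda>x. char_factor e (f x))"
  unfolding char_factor_def by (intro continuous_intros) auto

lemma norm_char_factor_ge:
  assumes e: "\<And>a. 0 \<le> e a \<and> e a \<le> 1" and "0 \<le> y"
  shows "1 - y \<le> cmod (char_factor e y)"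
proof -
  have cis1: "cmod (cis x - 1) \<le> x" if "x \<ge> 0" for x
  proof -
    have "(cmod (cis x - 1))^2 = 2 - 2 * cos x"
      using sin_cos_squared_add[of x] by (simp add: cmod_power2) (simp add: power2_eq_square algebra_simps)
    also have "\<dots> = (2 * sin (x / 2))^2" using cos_double_sin[of "x / 2"] by (simp add: power_mult_distrib)
    also have "\<dots> \<le> x^2"
      using abs_sin_x_le_abs_x[of "x / 2"] by (intro iffD1[OF abs_le_square_iff]) (auto simp: abs_mult)
    finally show ?thesis using that by (rule power2_le_imp_le)
  qed
  have "char_factor e y - 1 = (\<Sum>a\<in>UNIV. cis (y * e a) - 1) / 3"
    by (simp add: char_factor_def sum_subtractf diff_divide_distrib)
  then have "cmod (char_factor e y - 1) = cmod (\<Sum>a\<in>UNIV. cis (y * e a) - 1) / 3"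
    by (simp only: norm_divide) simp
  also have "\<dots> \<le> (\<Sum>a\<in>(UNIV :: 3 set). y) / 3"
  proof (intro divide_right_mono sum_norm_le)
    fix a :: 3
    have "cmod (cis (y * e a) - 1) \<le> y * e a" using assms(2) e[of a] by (intro cis1) auto
    also have "\<dots> \<le> y * 1" using e[of a] assms(2) by (intro mult_left_mono) auto
    finally show "cmod (cis (y * e a) - 1) \<le> y" by simp
  qed auto
  also have "\<dots> = y" by simp
  finally show ?thesis
    using norm_triangle_ineq2[of 1 "1 - char_factor e y"] by (simp add: norm_minus_commute)
qed

text \<open>
  The losses $y/3^k$ of the single factors form a geometric series with sum $\frac32 y$.
\<close>
lemma prod_char_factor_tail_ge:
  assumes e: "\<And>a. 0 \<le> e a \<and> e a \<le> 1" and "0 \<le> y" "y \<le> 1"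
  shows "1 - 3 / 2 * y \<le> (\<Prod>k<n. cmod (char_factor e (y / 3 ^ k)))"
  using assms(2,3)
proof (induction n arbitrary: y)
  case (Suc n)
  have p0: "0 \<le> (\<Prod>k<n. cmod (char_factor e (y / 3 / 3 ^ k)))" by (intro prod_nonneg) auto
  have "1 - 3 / 2 * y \<le> (1 - y) * (1 - 3 / 2 * (y / 3))" using Suc.prems by (simp add: algebra_simps)
  also have "\<dots> \<le> (1 - y) * (\<Prod>k<n. cmod (char_factor e (y / 3 / 3 ^ k)))"
    using Suc.prems by (intro mult_left_mono Suc.IH) auto
  also have "\<dots> \<le> cmod (char_factor e y) * (\<Prod>k<n. cmod (char_factor e (y / 3 / 3 ^ k)))"
    using Suc.prems by (intro mult_right_mono p0 norm_char_factor_ge e)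
  also have "\<dots> = (\<Prod>k<Suc n. cmod (char_factor e (y / 3 ^ k)))"
    by (simp only: prod.lessThan_Suc_shift) simp
  finally show ?case .
qed simp

lemma integral_telescope:
  fixes f :: "real \<Rightarrow> real"
  assumes f: "continuous_on UNIV f" and a: "\<And>n. a n \<le> a (Suc n)"
  shows "(\<Sum>n<R. integral {a n..a (Suc n)} f) = integral {a 0..a R} f"
proof (induction R)
  case (Suc R)
  have "a 0 \<le> a R" by (rule lift_Suc_mono_le[of a]) (auto intro: a)
  then show ?case using Suc a[of R]
    by (simp, intro Henstock_Kurzweil_Integration.integral_combine integrable_continuous_interval
        continuous_on_subset[OF f]) auto
qed simp

text \<open>
  A partial Riesz product: the normalised energy density of the digit sums of length $n$.
\<close>
definition riesz :: "(3 \<Rightarrow> real) \<Rightarrow> nat \<Rightarrow> real \<Rightarrow> real" where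
  "riesz e n \<xi> = (\<Prod>k<n. (cmod (char_factor e (\<xi> / 3 ^ k)))^2)"

lemma continuous_on_riesz: "continuous_on S (riesz e n)"
  unfolding riesz_def by (intro continuous_intros) auto

lemma riesz_nonneg: "0 \<le> riesz e n \<xi>"
  unfolding riesz_def by (intro prod_nonneg) auto

lemma riesz_eq_energy:
  "(cmod (\<Sum>w\<in>words n. cis (\<xi> * digit_sum e w)))^2 = 9 ^ n * riesz e n \<xi>"
proof -
  have "(3 ^ n)^2 = (9::real) ^ n" by (simp flip: power_mult add: mult.commute[of n]) (simp add: power_mult)
  then show ?thesis
    by (simp add: sum_words_cis riesz_def norm_mult norm_power prod_norm[symmetric] power_mult_distrib prod_power_distrib)
qed

lemma integral_riesz_ge: "3 ^ m / 2 \<le> integral {0..3 ^ (l + m)} (riesz e l)"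
proof -
  have "real (card (words l)) * 3 ^ (l + m) / 2 \<le> 9 ^ l * integral {0..3 ^ (l + m)} (riesz e l)"
    using energy_lower[of "words l" "3 ^ (l + m)" "digit_sum e"] by (simp add: riesz_eq_energy)
  then have "9 ^ l * (3 ^ m / 2) \<le> 9 ^ l * integral {0..3 ^ (l + m)} (riesz e l)"
    by (simp add: card_words power_add flip: power_mult_distrib mult.assoc)
  then show ?thesis by simp
qed

lemma integral_riesz_le:
  assumes "\<And>x. card {w \<in> words l. x \<le> digit_sum e w \<and> digit_sum e w \<le> x + 1 / 3 ^ l} \<le> K"
  shows "integral {c..c + 3 ^ l} (riesz e l) \<le> 36 * real K"
proof -
  have "9 ^ l * integral {c..c + 3 ^ l} (riesz e l) \<le> 36 * real K * 3 ^ l * real (card (words l))"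
    using energy_upper[of "words l" "3 ^ l" "digit_sum e" K c] assms by (simp add: riesz_eq_energy)
  also have "\<dots> = 9 ^ l * (36 * real K)"
    by (simp add: card_words mult.assoc flip: power_mult_distrib)
  finally show ?thesis by simp
qed

text \<open>
  Three ranges of factors: those before \<open>l\<close> are kept, the middle \<open>m + 1\<close> are at least \<open>d\<close>,
  and in the tail the argument is at most $\frac13$, so that the product of the moduli is at least
  $1 - \frac32 \cdot \frac13 = \frac12$.
\<close>
lemma riesz_split:
  assumes e: "\<And>a. 0 \<le> e a \<and> e a \<le> 1"
    and d: "0 \<le> d" "\<And>j. j \<le> m \<Longrightarrow> d \<le> cmod (char_factor e (\<xi> / 3 ^ (l + j)))"
    and N: "l + m + 1 \<le> N" and \<xi>: "0 \<le> \<xi>" "\<xi> \<le> 3 ^ (l + m)"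
  shows "d ^ (2 * m + 2) / 4 * riesz e l \<xi> \<le> riesz e N \<xi>"
proof -
  let ?c = "\<lambda>k. cmod (char_factor e (\<xi> / 3 ^ k))"
  obtain n where n: "N = l + (m + 1) + n" using N le_Suc_ex by (metis add.assoc)
  have "d ^ (2 * m + 2) = (\<Prod>j<m+1. d^2)" by (simp add: power_mult power_add power2_eq_square power_commutes)
  also have "\<dots> \<le> (\<Prod>j<m+1. (?c (l + j))^2)" using d by (intro prod_mono conjI power_mono) auto
  finally have mid: "d ^ (2 * m + 2) \<le> (\<Prod>j<m+1. (?c (l + j))^2)" .
  have "1 / 2 \<le> 1 - 3 / 2 * (\<xi> / 3 ^ (l + m + 1))" using \<xi> by (simp add: field_simps)
  also have "\<dots> \<le> (\<Prod>k<n. cmod (char_factor e ((\<xi> / 3 ^ (l + m + 1)) / 3 ^ k)))"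
  proof (rule prod_char_factor_tail_ge[OF e])
    show "\<xi> / 3 ^ (l + m + 1) \<le> 1" using \<xi> by (simp add: field_simps)
  qed (use \<xi> in auto)
  finally have "(1 / 2)^2 \<le> (\<Prod>k<n. ?c (l + (m + 1) + k))^2"
    by (intro power_mono) (simp_all add: power_add mult_ac)
  then have tail: "1 / 4 \<le> (\<Prod>k<n. (?c (l + (m + 1) + k))^2)"
    unfolding prod_power_distrib[symmetric] by (simp add: power_divide)
  have split: "(\<Prod>k<a + b. f k) = (\<Prod>k<a. f k) * (\<Prod>k<b. f (a + k))" for a b and f :: "nat \<Rightarrow> real"
    by (induction b) (auto simp: mult_ac)
  have "riesz e N \<xi> = riesz e l \<xi> * (\<Prod>j<m+1. (?c (l + j))^2) * (\<Prod>k<n. (?c (l + (m + 1) + k))^2)"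
    unfolding riesz_def n split ..
  moreover have "riesz e l \<xi> * d ^ (2 * m + 2) * (1 / 4)
      \<le> riesz e l \<xi> * (\<Prod>j<m+1. (?c (l + j))^2) * (\<Prod>k<n. (?c (l + (m + 1) + k))^2)"
    using d(1) by (intro mult_mono mid tail mult_nonneg_nonneg riesz_nonneg prod_nonneg) auto
  ultimately show ?thesis by (simp add: mult_ac)
qed

text \<open>
  Over $[0, 3^{l+m}]$ the first \<open>l\<close> factors have integral at least $3^m/2$, and $[0, 3^l]$
  contributes at most $36 K \le 3^m / 4$ of it. The rest is in the window.
\<close>
lemma integral_riesz_window_ge:
  fixes K m :: nat
  assumes e: "\<And>a. 0 \<le> e a \<and> e a \<le> 1" and d: "0 \<le> d"
    and K: "\<And>x. card {w \<in> words l. x \<le> digit_sum e w \<and> digit_sum e w \<le> x + 1 / 3 ^ l} \<le> K"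
    and good: "\<And>y. 0 \<le> y \<Longrightarrow> y \<le> 3 ^ m \<Longrightarrow> d \<le> cmod (char_factor e y)"
    and m: "144 * real K \<le> 3 ^ m" and N: "l + m + 1 \<le> N"
  shows "d ^ (2 * m + 2) * 3 ^ m / 16 \<le> integral {3 ^ l..3 ^ (l + m)} (riesz e N)"
proof -
  define c where "c = d ^ (2 * m + 2) / 4"
  have c0: "0 \<le> c" using d by (simp add: c_def)
  have int: "riesz e k integrable_on {x..y}" for k x y
    by (intro integrable_continuous_interval continuous_on_riesz)
  have le: "(3::real) ^ l \<le> 3 ^ (l + m)" by (intro power_increasing) auto
  have "3 ^ m / 2 \<le> integral {0..3 ^ (l + m)} (riesz e l)" by (rule integral_riesz_ge)
  also have "\<dots> = integral {0..0 + 3 ^ l} (riesz e l) + integral {3 ^ l..3 ^ (l + m)} (riesz e l)"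
    using Henstock_Kurzweil_Integration.integral_combine[of 0 "3 ^ l" "3 ^ (l + m)" "riesz e l"] le int by simp
  also have "integral {0..0 + 3 ^ l} (riesz e l) \<le> 36 * real K" by (rule integral_riesz_le[OF K])
  finally have "3 ^ m / 4 \<le> integral {3 ^ l..3 ^ (l + m)} (riesz e l)" using m by simp
  then have "c * (3 ^ m / 4) \<le> c * integral {3 ^ l..3 ^ (l + m)} (riesz e l)" using c0 by (rule mult_left_mono)
  also have "\<dots> = integral {3 ^ l..3 ^ (l + m)} (\<lambda>\<xi>. c * riesz e l \<xi>)" by simp
  also have "\<dots> \<le> integral {3 ^ l..3 ^ (l + m)} (riesz e N)"
  proof (intro integral_le integrable_continuous_interval continuous_on_riesz continuous_intros)
    fix \<xi> :: real assume "\<xi> \<in> {3 ^ l..3 ^ (l + m)}"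
    moreover have "0 \<le> (3::real) ^ l" by simp
    ultimately have \<xi>: "0 \<le> \<xi>" "\<xi> \<le> 3 ^ (l + m)" by (auto simp del: zero_le_power)
    show "c * riesz e l \<xi> \<le> riesz e N \<xi>"
      unfolding c_def
    proof (rule riesz_split[OF e d _ N \<xi>])
      show "d \<le> cmod (char_factor e (\<xi> / 3 ^ (l + j)))" for j
      proof (rule good)
        have "\<xi> / 3 ^ (l + j) \<le> 3 ^ (l + m) / 3 ^ l"
          using \<xi> by (intro frac_le power_increasing) auto
        then show "\<xi> / 3 ^ (l + j) \<le> 3 ^ m" by (simp add: power_add)
      qed (use \<xi> in simp)
    qed
  qed
  finally show ?thesis by (simp add: c_def)
qed

text \<open>
  The windows tile $[1, 3^{Rm}]$, on which the whole energy is at most $36 K$, while each of them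
  carries a fixed amount. If \<open>R\<close> violates the conclusion, some interval of length $3^{-l}$ with
  $l \le Rm + 1$ must contain the digit sums of more than \<open>K\<close> words.
\<close>
lemma number_of_windows_le_if_no_stack:
  fixes K m R :: nat
  assumes e: "\<And>a. 0 \<le> e a \<and> e a \<le> 1" and d: "0 \<le> d"
    and K: "\<And>l x. l \<le> R * m + 1 \<Longrightarrow>
      card {w \<in> words l. x \<le> digit_sum e w \<and> digit_sum e w \<le> x + 1 / 3 ^ l} \<le> K"
    and good: "\<And>y. 0 \<le> y \<Longrightarrow> y \<le> 3 ^ m \<Longrightarrow> d \<le> cmod (char_factor e y)"
    and m: "144 * real K \<le> 3 ^ m"
  shows "real R * d ^ (2 * m + 2) * 3 ^ m \<le> 576 * real K"
proof -
  define N where "N = R * m + 1"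
  define b where "b r = (3::real) ^ (r * m)" for r
  have bS: "b r \<le> b (Suc r)" for r unfolding b_def by (intro power_increasing) auto
  have int: "riesz e N integrable_on {x..y}" for x y
    by (intro integrable_continuous_interval continuous_on_riesz)
  have "real R * (d ^ (2 * m + 2) * 3 ^ m / 16) = (\<Sum>r<R. d ^ (2 * m + 2) * 3 ^ m / 16)" by simp
  also have "\<dots> \<le> (\<Sum>r<R. integral {b r..b (Suc r)} (riesz e N))"
  proof (rule sum_mono)
    fix r assume "r \<in> {..<R}"
    then have "Suc r * m \<le> R * m" by (intro mult_right_mono) auto
    then have r: "r * m + m + 1 \<le> N" "r * m \<le> R * m + 1" by (auto simp: N_def)
    show "d ^ (2 * m + 2) * 3 ^ m / 16 \<le> integral {b r..b (Suc r)} (riesz e N)"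
      using integral_riesz_window_ge[where e = e, OF e d K[OF r(2)] good m r(1)] by (simp add: b_def add.commute)
  qed
  also have "\<dots> = integral {b 0..b R} (riesz e N)"
    by (rule integral_telescope) (auto simp: bS continuous_on_riesz)
  also have "\<dots> \<le> integral {0..0 + 3 ^ N} (riesz e N)"
    by (intro integral_subset_le int) (auto simp: b_def N_def riesz_nonneg intro: order_trans)
  also have "\<dots> \<le> 36 * real K" by (rule integral_riesz_le) (rule K, simp add: N_def)
  finally show ?thesis by simp
qed

section \<open>Where a factor is small\<close>
lemma jordan_inequality:
  fixes x :: real assumes "0 \<le> x" "x \<le> 1 / 2"
  shows "2 * x \<le> sin (pi * x)"
proof -
  have "convex_on {0..pi} (\<lambda>x. - sin x)"
  proof (rule f''_ge0_imp_convex)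
    show "((\<lambda>x. - sin x) has_real_derivative - cos x) (at x)" for x
      by (auto intro!: derivative_eq_intros)
    show "((\<lambda>x. - cos x) has_real_derivative sin x) (at x)" for x
      by (auto intro!: derivative_eq_intros)
  qed (auto intro: sin_ge_zero)
  from convex_onD[OF this, of "2 * x" 0 "pi / 2"] assms show ?thesis by (simp add: mult.commute)
qed

lemma dist_round_le_sin:
  fixes x :: real
  shows "2 * \<bar>x - of_int (round x)\<bar> \<le> \<bar>sin (pi * x)\<bar>"
proof -
  define r where "r = x - of_int (round x)"
  have r: "\<bar>r\<bar> \<le> 1 / 2" using of_int_round_abs_le[of x] by (simp add: r_def abs_minus_commute)
  have "pi * x = pi * r + pi * of_int (round x)" by (simp add: r_def algebra_simps)
  then have "\<bar>sin (pi * x)\<bar> = \<bar>sin (pi * r)\<bar>"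
    by (simp add: sin_add cos_npi_int sin_npi_int abs_mult)
  also have "\<bar>sin (pi * r)\<bar> = \<bar>sin (pi * \<bar>r\<bar>)\<bar>" by (auto simp: abs_if)
  also have "2 * \<bar>r\<bar> \<le> \<dots>" using jordan_inequality[of "\<bar>r\<bar>"] r by linarith
  finally show ?thesis unfolding r_def by simp
qed

text \<open>
  If three unit complex numbers with sum close to 0 include 1, the other two are close to the
  primitive cube roots of unity. Here this follows from $|1 + e^{iy}| \approx 1$, that is
  $2 \cos y + 1 \approx 0$, and $\sin(3y/2) = \sin(y/2)\,(2\cos y + 1)$.
\<close>
lemma near_third_root_of_unity:
  assumes "cmod (1 + cis y + cis z) \<le> h"
  shows "\<bar>3 * y / (2 * pi) - of_int (round (3 * y / (2 * pi)))\<bar> \<le> 3 / 2 * h"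
proof -
  have "\<bar>cmod (1 + cis y) - 1\<bar> \<le> h"
    using assms norm_triangle_ineq2[of "1 + cis y" "- cis z"] norm_triangle_ineq2[of "- cis z" "1 + cis y"]
      norm_minus_commute[of "1 + cis y" "- cis z"] by (simp add: abs_le_iff)
  moreover have "cmod (1 + cis y) \<le> 2" using norm_triangle_ineq[of 1 "cis y"] by simp
  ultimately have "\<bar>cmod (1 + cis y) - 1\<bar> * \<bar>cmod (1 + cis y) + 1\<bar> \<le> h * 3"
    by (intro mult_mono) auto
  then have "\<bar>(cmod (1 + cis y))^2 - 1\<bar> \<le> 3 * h"
    unfolding abs_mult[symmetric] by (simp add: power2_eq_square algebra_simps)
  moreover have "(cmod (1 + cis y))^2 = 2 + 2 * cos y"
    by (simp add: cmod_power2) (simp add: power2_eq_square algebra_simps)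
  ultimately have c: "\<bar>2 * cos y + 1\<bar> \<le> 3 * h" by simp
  have "sin (3 * (y / 2)) = sin (y / 2) * (2 * cos y + 1)"
  proof -
    have "sin (3 * (y / 2)) = sin (y / 2 + y)" by (simp add: field_simps)
    also have "\<dots> = sin (y / 2) * cos y + cos (y / 2) * sin (2 * (y / 2))" by (simp only: sin_add) simp
    also have "sin (2 * (y / 2)) = 2 * sin (y / 2) * cos (y / 2)" by (rule sin_double)
    also have "sin (y / 2) * cos y + cos (y / 2) * (2 * sin (y / 2) * cos (y / 2))
       = sin (y / 2) * (cos (2 * (y / 2)) + 2 * (cos (y / 2))^2)" by (simp add: power2_eq_square algebra_simps)
    also have "2 * (cos (y / 2))^2 = cos (2 * (y / 2)) + 1" using cos_double_cos[of "y / 2"] by simp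
    finally show ?thesis by simp
  qed
  then have "\<bar>sin (3 * (y / 2))\<bar> \<le> 1 * (3 * h)"
    unfolding abs_mult[symmetric] using c by (simp only: abs_mult) (intro mult_mono, auto)
  moreover have "pi * (3 * y / (2 * pi)) = 3 * (y / 2)" by simp
  ultimately show ?thesis using dist_round_le_sin[of "3 * y / (2 * pi)"] by simp
qed

text \<open>
  With $x = 3y/2\pi$, both $x$ and $t x$ are nearly integers $a$ and $b$, and $ta - b$ differs from
  $tx - b$ by at most $|x - a|$. The case $a = 0$ is excluded because then $y$ is close to 0, where
  the factor is close to 1. Since $3/2\pi \le \frac12$, the bound on $y$ passes to $a$.
\<close>
lemma char_factor_small_imp:
  fixes i j k :: 3
  assumes ijk: "i \<noteq> j" "i \<noteq> k" "j \<noteq> k" and e: "e i = 0" "e j = 1" "0 \<le> e k" "e k \<le> 1"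
    and small: "cmod (char_factor e y) < d" and d: "d \<le> 1 / 100" and y: "0 \<le> y" "y \<le> real M"
  shows "\<exists>a b. 1 \<le> a \<and> a \<le> M \<and> b \<le> a \<and> \<bar>real a * e k - real b\<bar> \<le> 10 * d"
proof -
  have d0: "d > 0" using small norm_ge_zero[of "char_factor e y"] by linarith
  define t where "t = e k"
  have univ: "(UNIV :: 3 set) = {i, j, k}"
    using ijk by (intro card_subset_eq[symmetric]) auto
  have "3 * cmod (char_factor e y) = cmod (3 * char_factor e y)" by (simp add: norm_mult)
  also have "3 * char_factor e y = 1 + cis y + cis (t * y)"
    unfolding char_factor_def univ using ijk e by (simp add: t_def mult.commute)
  finally have s: "cmod (1 + cis y + cis (t * y)) \<le> 3 * d" using small by simp
  then have s': "cmod (1 + cis (t * y) + cis y) \<le> 3 * d" by (simp add: add_ac)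
  define x where "x = 3 * y / (2 * pi)"
  define z where "z = round x"
  define b where "b = round (t * x)"
  have x: "\<bar>x - of_int z\<bar> \<le> 9 / 2 * d" using near_third_root_of_unity[OF s] by (simp add: x_def z_def)
  have tx: "\<bar>t * x - of_int b\<bar> \<le> 9 / 2 * d"
    using near_third_root_of_unity[OF s'] by (simp add: x_def b_def mult_ac)
  have x0: "0 \<le> x" using y by (simp add: x_def)
  have z1: "1 \<le> z"
  proof (rule ccontr)
    assume "\<not> 1 \<le> z"
    then have "x \<le> 9 / 2 * d" using x by linarith
    then have "x \<le> 45 / 1000" using d by simp
    then have "3 * y \<le> 45 / 1000 * (2 * pi)" by (simp add: x_def pos_divide_le_eq)
    then have "y \<le> 1 / 2" using pi_less_4 by simp
    have "1 - y \<le> cmod (char_factor e y)"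
    proof (rule norm_char_factor_ge)
      show "0 \<le> e a \<and> e a \<le> 1" for a
      proof -
        have "a \<in> {i, j, k}" using univ by blast
        then show ?thesis using e by auto
      qed
    qed (rule y)
    then show False using small d \<open>y \<le> 1 / 2\<close> by linarith
  qed
  have "\<bar>t * (x - of_int z)\<bar> \<le> 1 * (9 / 2 * d)" unfolding abs_mult using x e by (intro mult_mono) (auto simp: t_def)
  then have tz: "\<bar>t * of_int z - of_int b\<bar> \<le> 9 * d" unfolding right_diff_distrib mult_1 using tx by linarith
  have tz01: "0 \<le> t * of_int z" "t * of_int z \<le> of_int z" using e z1 by (auto simp: t_def mult_left_le_one_le)
  have "0 \<le> b" "b \<le> z" using tz tz01 d by linarith+
  have "x \<le> y * (1 / 2)"
    using mult_right_mono[of 3 pi y] y(1) pi_gt3 unfolding x_def by (simp add: field_simps)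
  moreover have "1 / 2 \<le> x" using x z1 d by linarith
  ultimately have "of_int z \<le> real M" using x d y by linarith
  then have "nat z \<le> M" using z1 by linarith
  moreover have "1 \<le> nat z" "nat b \<le> nat z" using z1 \<open>b \<le> z\<close> by auto
  moreover have "\<bar>real (nat z) * e k - real (nat b)\<bar> \<le> 10 * d"
    using tz d0 z1 \<open>0 \<le> b\<close> by (simp add: t_def mult.commute)
  ultimately show ?thesis by blast
qed

section \<open>Resonant directions\<close>
lemma inner_direction: "w \<bullet> direction \<theta> = w $ 1 * cos \<theta> + w $ 2 * sin \<theta>"
  by (simp add: direction_def inner_vec_def sum_2)

lemma norm_direction [simp]: "norm (direction \<theta>) = 1"
  unfolding norm_eq_sqrt_inner inner_direction by (simp add: direction_def power2_eq_square[symmetric])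

lemma borel_measurable_inner_direction [measurable]: "(\<lambda>\<theta>. w \<bullet> direction \<theta>) \<in> borel_measurable borel"
  unfolding inner_direction by measurable

text \<open>
  In polar coordinates the inner product is a multiple of a shifted sine, which is small only near
  its zeros, by \<open>dist_round_le_sin\<close>. Only four of the zeros can be the nearest one to a point
  of $[0, \pi]$.
\<close>
lemma emeasure_almost_orthogonal_le:
  fixes w :: "real ^ 2"
  assumes w: "w \<noteq> 0" and h: "0 \<le> h"
  shows "emeasure lborel {\<theta> \<in> {0..pi}. \<bar>w \<bullet> direction \<theta>\<bar> \<le> h} \<le> ennreal (4 * pi * h / norm w)"
proof -
  have nw: "(norm w)^2 = (w $ 1)^2 + (w $ 2)^2"
    by (simp add: norm_vec_def L2_set_def sum_2)
  have "(w $ 1 / norm w)^2 + (w $ 2 / norm w)^2 = 1"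
    using w by (simp add: power_divide nw[symmetric] flip: add_divide_distrib)
  then obtain \<alpha> where \<alpha>: "0 \<le> \<alpha>" "\<alpha> < 2 * pi" "w $ 1 / norm w = cos \<alpha>" "w $ 2 / norm w = sin \<alpha>"
    by (rule sincos_total_2pi)
  define r where "r = pi * h / (2 * norm w)"
  have r0: "0 \<le> r" using h by (simp add: r_def)
  \<comment> \<open>The zeros of the shifted sine.\<close>
  define c where "c z = pi * (of_int z - 1 / 2) + \<alpha>" for z :: int
  have sub: "{\<theta> \<in> {0..pi}. \<bar>w \<bullet> direction \<theta>\<bar> \<le> h} \<subseteq> (\<Union>z\<in>{-1..2}. {c z - r..c z + r})"
  proof
    fix \<theta> assume "\<theta> \<in> {\<theta> \<in> {0..pi}. \<bar>w \<bullet> direction \<theta>\<bar> \<le> h}"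
    then have \<theta>: "0 \<le> \<theta>" "\<theta> \<le> pi" "\<bar>w \<bullet> direction \<theta>\<bar> \<le> h" by auto
    define x where "x = (\<theta> - \<alpha>) / pi + 1 / 2"
    have "w $ 1 = norm w * cos \<alpha>" "w $ 2 = norm w * sin \<alpha>" using \<alpha> w by (auto simp: field_simps)
    then have "w \<bullet> direction \<theta> = norm w * cos (\<theta> - \<alpha>)" by (simp add: inner_direction cos_diff algebra_simps)
    also have "cos (\<theta> - \<alpha>) = sin (pi * x)"
    proof -
      have "pi * x = (\<theta> - \<alpha>) + pi / 2" by (simp add: x_def distrib_left)
      then show ?thesis by (simp only: sin_add) simp
    qed
    finally have "norm w * \<bar>sin (pi * x)\<bar> \<le> h" using \<theta>(3) by (simp add: abs_mult)
    moreover have "norm w * (2 * \<bar>x - of_int (round x)\<bar>) \<le> norm w * \<bar>sin (pi * x)\<bar>"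
      by (intro mult_left_mono dist_round_le_sin) auto
    ultimately have "norm w * (2 * \<bar>x - of_int (round x)\<bar>) \<le> h" by linarith
    then have "pi * \<bar>x - of_int (round x)\<bar> \<le> r" using w by (simp add: r_def field_simps)
    then have "\<bar>pi * (x - of_int (round x))\<bar> \<le> r" by (simp only: abs_mult) simp
    moreover have "pi * (x - of_int (round x)) = \<theta> - c (round x)" by (simp add: c_def x_def field_simps)
    ultimately have near: "\<bar>\<theta> - c (round x)\<bar> \<le> r" by simp
    have "- 3 / 2 < x" "x \<le> 3 / 2"
      using \<alpha>(1,2) \<theta>(1,2) by (auto simp: x_def field_simps)
    then have "round x \<in> {-1..2}" using of_int_round_ge[of x] of_int_round_le[of x] by auto
    then show "\<theta> \<in> (\<Union>z\<in>{-1..2}. {c z - r..c z + r})" using near by (intro UN_I[of "round x"]) auto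
  qed
  have "emeasure lborel {\<theta> \<in> {0..pi}. \<bar>w \<bullet> direction \<theta>\<bar> \<le> h}
      \<le> emeasure lborel (\<Union>z\<in>{-1..2}. {c z - r..c z + r})"
    by (rule emeasure_mono[OF sub]) auto
  also have "\<dots> \<le> (\<Sum>z\<in>{-1..2}. emeasure lborel {c z - r..c z + r})"
    by (rule emeasure_subadditive_finite) auto
  also have "\<dots> = (\<Sum>z\<in>{-1..2::int}. ennreal (2 * r))"
    using r0 by (intro sum.cong) auto
  also have "\<dots> = ennreal (4 * (2 * r))" using r0 by (simp add: ennreal_mult)
  also have "4 * (2 * r) = 4 * pi * h / norm w" by (simp add: r_def)
  finally show ?thesis .
qed

text \<open>
  The squared length is $s^2 (a^2 - ab + b^2)$, and $a^2 - ab + b^2 = \frac34 a^2 + (b - a/2)^2$.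
\<close>
lemma norm_lattice_combination_ge:
  fixes v :: "3 \<Rightarrow> real ^ 2"
  assumes s: "s > 0" "\<And>i j. i \<noteq> j \<Longrightarrow> dist (v i) (v j) = s" and ijk: "i \<noteq> j" "i \<noteq> k" "j \<noteq> k"
    and a: "a \<ge> 0"
  shows "a * s / 2 \<le> norm (a *\<^sub>R (v k - v i) - b *\<^sub>R (v j - v i))"
proof -
  let ?x = "v k - v i" and ?y = "v j - v i"
  have nx: "norm ?x = s" and ny: "norm ?y = s" and nxy: "norm (?x - ?y) = s"
    using s(2)[of k i] s(2)[of j i] s(2)[of k j] ijk by (auto simp: dist_norm)
  have xy: "2 * (?x \<bullet> ?y) = s^2"
    using dot_norm_neg[of ?x ?y] unfolding nx ny nxy by simp
  have "(norm (a *\<^sub>R ?x - b *\<^sub>R ?y))^2 = a^2 * s^2 - a * b * (2 * (?x \<bullet> ?y)) + b^2 * s^2"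
  proof -
    have "?x \<bullet> ?x = s^2" "?y \<bullet> ?y = s^2" using nx ny by (simp_all add: dot_square_norm)
    then show ?thesis
      by (simp add: power2_norm_eq_inner inner_diff_left[of "a *\<^sub>R _"] inner_diff_right[of _ "a *\<^sub>R _"])
        (simp add: power2_eq_square algebra_simps inner_commute)
  qed
  also have "\<dots> = s^2 * ((a / 2)^2 * 3 + (b - a / 2)^2)" unfolding xy by (simp add: power2_eq_square algebra_simps)
  also have "\<dots> \<ge> s^2 * (a / 2)^2"
    by (intro mult_left_mono) auto
  finally have "(a * s / 2)^2 \<le> (norm (a *\<^sub>R ?x - b *\<^sub>R ?y))^2" by (simp add: power_mult_distrib power_divide mult.commute)
  then show ?thesis by (rule power2_le_imp_le) simp
qed

text \<open>
  The directions in which, for some order of the vertices, the middle digit $t$ is well approximated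
  by a fraction $b/a$ with $a \le M$.
  Stating it through the inner product avoids dividing by the length of the projection, and makes the
  set a finite union of directions almost orthogonal to a fixed vector.
\<close>
definition resonant :: "(3 \<Rightarrow> real ^ 2) \<Rightarrow> nat \<Rightarrow> real \<Rightarrow> real set" where
  "resonant v M h = (\<Union>a\<in>{1..M}. \<Union>b\<in>{..a}. \<Union>(i, j, k)\<in>{(i, j, k). i \<noteq> j \<and> i \<noteq> k \<and> j \<noteq> k}.
     {\<theta> \<in> {0..pi}. \<bar>(real a *\<^sub>R (v k - v i) - real b *\<^sub>R (v j - v i)) \<bullet> direction \<theta>\<bar> \<le> h})"

lemma resonant_sets [measurable]: "resonant v M h \<in> sets borel"
  unfolding resonant_def by (intro sets.finite_UN) auto

text \<open>
  For each $a$ there are $a + 1$ values of $b$, each contributing $O(h / (as))$, so every $a$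
  contributes $O(h/s)$.
\<close>
lemma emeasure_resonant_le:
  fixes v :: "3 \<Rightarrow> real ^ 2"
  assumes s: "s > 0" "\<And>i j. i \<noteq> j \<Longrightarrow> dist (v i) (v j) = s" and h: "0 \<le> h"
  shows "emeasure lborel (resonant v M h) \<le> ennreal (432 * pi * real M * h / s)"
proof -
  let ?T = "{(i, j, k). i \<noteq> j \<and> i \<noteq> k \<and> j \<noteq> k} :: (3 \<times> 3 \<times> 3) set"
  let ?w = "\<lambda>a b. \<lambda>(i, j, k). real a *\<^sub>R (v k - v i) - real b *\<^sub>R (v j - v i)"
  let ?Z = "\<lambda>a b t. {\<theta> \<in> {0..pi}. \<bar>?w a b t \<bullet> direction \<theta>\<bar> \<le> h}"
  have Z: "emeasure lborel (?Z a b t) \<le> ennreal (8 * pi * h / (real a * s))" if "a \<ge> 1" "t \<in> ?T" for a b t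
  proof -
    have n: "real a * s / 2 \<le> norm (?w a b t)"
      using norm_lattice_combination_ge[of s v] s that(2) by (auto split: prod.splits)
    moreover have p: "real a * s / 2 > 0" using s that by simp
    ultimately have "emeasure lborel (?Z a b t) \<le> ennreal (4 * pi * h / norm (?w a b t))"
      by (intro emeasure_almost_orthogonal_le h) auto
    also have "\<dots> \<le> ennreal (4 * pi * h / (real a * s / 2))"
      by (intro ennreal_leI frac_le n p) (use h in auto)
    finally show ?thesis by (simp add: mult_ac)
  qed
  have cT: "card ?T \<le> 27"
    using card_mono[of "UNIV :: (3 \<times> 3 \<times> 3) set" ?T] by simp
  have eq: "resonant v M h = (\<Union>(a, b, t)\<in>(SIGMA a:{1..M}. {..a} \<times> ?T). ?Z a b t)"
    unfolding resonant_def by fastforce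
  have "emeasure lborel (resonant v M h) \<le> (\<Sum>(a, b, t)\<in>(SIGMA a:{1..M}. {..a} \<times> ?T). emeasure lborel (?Z a b t))"
    unfolding eq by (rule order_trans[OF emeasure_subadditive_finite]) (auto simp: case_prod_beta)
  also have "\<dots> \<le> (\<Sum>(a, b, t)\<in>(SIGMA a:{1..M}. {..a} \<times> ?T). ennreal (8 * pi * h / (real a * s)))"
    by (intro sum_mono) (use Z in \<open>auto split: prod.splits\<close>)
  also have "\<dots> = (\<Sum>a\<in>{1..M}. ennreal (real ((a + 1) * card ?T) * (8 * pi * h / (real a * s))))"
  proof -
    have "(\<Sum>(a, b, t)\<in>(SIGMA a:{1..M}. {..a} \<times> ?T). ennreal (8 * pi * h / (real a * s)))
        = (\<Sum>a\<in>{1..M}. \<Sum>p\<in>{..a} \<times> ?T. ennreal (8 * pi * h / (real a * s)))"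
      by (subst sum.Sigma) (auto simp: case_prod_beta)
    also have "\<dots> = (\<Sum>a\<in>{1..M}. ennreal (real ((a + 1) * card ?T) * (8 * pi * h / (real a * s))))"
    proof (intro sum.cong refl)
      fix a
      have "(\<Sum>p\<in>{..a} \<times> ?T. ennreal (8 * pi * h / (real a * s)))
          = of_nat ((a + 1) * card ?T) * ennreal (8 * pi * h / (real a * s))"
        by (simp only: sum_constant card_cartesian_product card_atMost Suc_eq_plus1)
      also have "\<dots> = ennreal (real ((a + 1) * card ?T) * (8 * pi * h / (real a * s)))"
        unfolding ennreal_of_nat_eq_real_of_nat by (rule ennreal_mult[symmetric]) (use h s in auto)
      finally show "(\<Sum>p\<in>{..a} \<times> ?T. ennreal (8 * pi * h / (real a * s)))
          = ennreal (real ((a + 1) * card ?T) * (8 * pi * h / (real a * s)))" .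
    qed
    finally show ?thesis .
  qed
  also have "\<dots> \<le> (\<Sum>a\<in>{1..M}. ennreal (432 * pi * h / s))"
  proof (intro sum_mono ennreal_leI)
    fix a assume a: "a \<in> {1..M}"
    have "(a + 1) * card ?T \<le> (2 * a) * 27" using a cT by (intro mult_mono) auto
    then have "real ((a + 1) * card ?T) \<le> 54 * real a" by linarith
    then have "real ((a + 1) * card ?T) * (8 * pi * h / (real a * s)) \<le> 54 * real a * (8 * pi * h / (real a * s))"
      by (rule mult_right_mono) (use h s in auto)
    also have "\<dots> = 432 * pi * h / s" using a by simp
    finally show "real ((a + 1) * card ?T) * (8 * pi * h / (real a * s)) \<le> 432 * pi * h / s" .
  qed
  also have "\<dots> = ennreal (432 * pi * real M * h / s)" using h s by (simp add: ennreal_mult[symmetric] ennreal_of_nat_eq_real_of_nat mult_ac)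
  finally show ?thesis .
qed

section \<open>Projections of the gasket in a fixed direction\<close>
lemma exists_sorted_indices:
  fixes p :: "3 \<Rightarrow> real"
  obtains i j k where "i \<noteq> j" "i \<noteq> k" "j \<noteq> k" "p i \<le> p k" "p k \<le> p j"
proof -
  have d: "(1::3) \<noteq> 2" "(1::3) \<noteq> 3" "(2::3) \<noteq> 3" by simp_all
  consider "p 1 \<le> p 2 \<and> p 2 \<le> p 3" | "p 1 \<le> p 3 \<and> p 3 \<le> p 2" | "p 2 \<le> p 1 \<and> p 1 \<le> p 3"
    | "p 2 \<le> p 3 \<and> p 3 \<le> p 1" | "p 3 \<le> p 1 \<and> p 1 \<le> p 2" | "p 3 \<le> p 2 \<and> p 2 \<le> p 1"
    by linarith
  then show ?thesis
  proof cases
    case 1 then show ?thesis using that[of 1 3 2] d by auto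
  next
    case 2 then show ?thesis using that[of 1 2 3] d by auto
  next
    case 3 then show ?thesis using that[of 2 3 1] d by auto
  next
    case 4 then show ?thesis using that[of 2 1 3] d by auto
  next
    case 5 then show ?thesis using that[of 3 2 1] d by auto
  next
    case 6 then show ?thesis using that[of 3 1 2] d by auto
  qed
qed

lemma mem_three_indices:
  fixes i j k :: 3
  assumes "i \<noteq> j" "i \<noteq> k" "j \<noteq> k" shows "a \<in> {i, j, k}"
proof -
  have "{i, j, k} = UNIV" using assms by (intro card_subset_eq) auto
  then show ?thesis by blast
qed

lemma direction_digits:
  fixes v :: "3 \<Rightarrow> real ^ 2"
  assumes s: "\<And>i j. i \<noteq> j \<Longrightarrow> dist (v i) (v j) = s"
  obtains i j k D e where "i \<noteq> j" "i \<noteq> k" "j \<noteq> k" "0 \<le> D" "D \<le> s"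
    "e i = 0" "e j = 1" "0 \<le> e k" "e k \<le> 1" "\<forall>a. v a \<bullet> direction \<theta> = v i \<bullet> direction \<theta> + D * e a"
proof -
  define p where "p a = v a \<bullet> direction \<theta>" for a
  obtain i j k where ijk: "i \<noteq> j" "i \<noteq> k" "j \<noteq> k" and p: "p i \<le> p k" "p k \<le> p j"
    by (rule exists_sorted_indices)
  define D where "D = p j - p i"
  \<comment> \<open>If all three vertices project to one point then D = 0, and the middle digit is 0 / 0 = 0.\<close>
  define e where "e a = (if a = j then 1 else if a = k then (p k - p i) / D else 0)" for a
  have D: "0 \<le> D" using p by (simp add: D_def)
  have "D = (v j - v i) \<bullet> direction \<theta>" by (simp add: D_def p_def inner_diff_left)
  also have "\<dots> \<le> norm (v j - v i) * norm (direction \<theta>)" by (rule norm_cauchy_schwarz)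
  also have "\<dots> = s" using s[of j i] ijk by (simp add: dist_norm)
  finally have "D \<le> s" .
  moreover have "e i = 0" "e j = 1" using ijk by (auto simp: e_def)
  moreover have "0 \<le> e k" "e k \<le> 1" using ijk p D by (auto simp: e_def D_def divide_le_eq_1)
  moreover have "p a = p i + D * e a" for a
    using mem_three_indices[OF ijk, of a] ijk p by (auto simp: e_def D_def)
  ultimately show ?thesis using that[of i j k D e] ijk D unfolding p_def by blast
qed

lemma inner_word_map:
  assumes "\<And>a. v a \<bullet> u = c + D * e a"
  shows "word_map v js x \<bullet> u = c + 2 / 3 * D * digit_sum e js + (x \<bullet> u - c) / 3 ^ length js"
proof (induction js)
  case (Cons j js)
  have "word_map v (j # js) x = contraction v j (word_map v js x)" by (simp add: word_map_def)
  then have "word_map v (j # js) x \<bullet> u = 2 / 3 * (v j \<bullet> u) + (word_map v js x \<bullet> u) / 3"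
    by (simp add: contraction_def inner_add_left inner_diff_left diff_divide_distrib)
  then show ?case unfolding Cons assms by (simp add: field_simps)
qed (simp add: word_map_def)

lemma line_measure_le_proj_approx:
  fixes v :: "3 \<Rightarrow> real ^ 2"
  assumes D: "0 \<le> D" "D \<le> s" and e: "\<And>a. 0 \<le> e a \<and> e a \<le> 1"
    and v: "\<And>a. v a \<bullet> direction \<theta> = c + D * e a"
  shows "line_measure \<theta> (line_proj \<theta> ` gasket_approx v n) \<le> ennreal (s * measure lebesgue (proj_approx e n))"
proof -
  let ?u = "direction \<theta>"
  let ?T = "(\<lambda>z. (2 / 3 * D) *\<^sub>R z + c) ` proj_approx e n"
  have uu: "?u \<bullet> ?u = 1" using norm_direction[of \<theta>] unfolding norm_eq_1 .
  have hull: "c \<le> x \<bullet> ?u \<and> x \<bullet> ?u \<le> c + D" if "x \<in> convex hull (range v)" for x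
  proof -
    have "convex hull (range v) \<subseteq> {x. ?u \<bullet> x \<ge> c} \<inter> {x. ?u \<bullet> x \<le> c + D}"
    proof (rule hull_minimal)
      show "range v \<subseteq> {x. ?u \<bullet> x \<ge> c} \<inter> {x. ?u \<bullet> x \<le> c + D}"
        using v e D by (auto simp: inner_commute[of ?u] mult_left_le)
    qed (intro convex_Int convex_halfspace_ge convex_halfspace_le)
    then show ?thesis using that by (auto simp: inner_commute)
  qed
  have "{t. t *\<^sub>R ?u \<in> line_proj \<theta> ` gasket_approx v n} \<subseteq> ?T"
  proof
    fix t assume "t \<in> {t. t *\<^sub>R ?u \<in> line_proj \<theta> ` gasket_approx v n}"
    then obtain js x where js: "length js = n" and x: "x \<in> convex hull (range v)"
      and t_eq: "t *\<^sub>R ?u = line_proj \<theta> (word_map v js x)"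
      by (auto simp: gasket_approx_def)
    have "(t *\<^sub>R ?u) \<bullet> ?u = ((word_map v js x \<bullet> ?u) *\<^sub>R ?u) \<bullet> ?u"
      unfolding t_eq line_proj_def ..
    then have t: "t = c + 2 / 3 * D * digit_sum e js + (x \<bullet> ?u - c) / 3 ^ n"
      using inner_word_map[where v = v and e = e and js = js and x = x, OF v] js by (simp only: inner_scaleR_left uu mult_1_right)
    show "t \<in> ?T"
    proof (cases "D = 0")
      case True
      then have "t = c" using t hull[OF x] by simp
      moreover obtain w :: "3 list" where "w \<in> words n" using js by (auto simp: words_def)
      ultimately show ?thesis
        using True by (intro image_eqI[where x = "digit_sum e w"]) (auto simp: proj_approx_def)
    next
      case False
      define r where "r = 3 / 2 * ((x \<bullet> ?u - c) / D)"
      have "0 \<le> (x \<bullet> ?u - c) / D" "(x \<bullet> ?u - c) / D \<le> 1"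
        using hull[OF x] D False by (auto simp: divide_le_eq_1)
      then have r: "0 \<le> r" "r \<le> 3 / 2" unfolding r_def by linarith+
      have "r / 3 ^ n \<le> 3 / 2 / 3 ^ n" using r by (intro divide_right_mono) auto
      then have "digit_sum e js + r / 3 ^ n \<in> proj_approx e n"
        using js r by (auto simp: proj_approx_def words_def intro!: bexI[of _ js])
      moreover have "t = (2 / 3 * D) *\<^sub>R (digit_sum e js + r / 3 ^ n) + c"
        unfolding t r_def using False by (simp add: field_simps)
      ultimately show ?thesis by blast
    qed
  qed
  then have "line_measure \<theta> (line_proj \<theta> ` gasket_approx v n) \<le> emeasure lebesgue ?T"
    unfolding line_measure_def
    by (rule emeasure_mono)
       (intro fmeasurableD lmeasurable_compact compact_continuous_image compact_proj_approx continuous_intros)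
  also have "\<dots> = ennreal (2 / 3 * D) * emeasure lebesgue (proj_approx e n)"
    unfolding emeasure_lebesgue_affine using D by simp
  also have "\<dots> = ennreal (2 / 3 * D * measure lebesgue (proj_approx e n))"
    unfolding emeasure_eq_measure2[OF proj_approx_measurable]
    by (rule ennreal_mult[symmetric]) (use D in auto)
  also have "\<dots> \<le> ennreal (s * measure lebesgue (proj_approx e n))"
    using D by (intro ennreal_leI mult_right_mono) auto
  finally show ?thesis .
qed

text \<open>
  A level up to which a stack of more than $3^q$ words must exist in every nonresonant direction. It
  has the form $Rm + 1$ with $m = q + 5$ and $R = 3 d^{-(2m+2)}$ for $d = 3^{-(2q+5)}$.
\<close>
definition stack_level :: "nat \<Rightarrow> nat" where
  "stack_level q = 3 ^ ((2 * q + 5) * (2 * q + 12) + 1) * (q + 5) + 1"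

text \<open>
  For this choice of \<open>R\<close> the inequality of \<open>number_of_windows_le_if_no_stack\<close> would read
  $3 \cdot 243 K \le 576 K$, so there is a stack, and \<open>stack_decay\<close> applies with $3^N$
  repetitions, where \<open>N\<close> is the level bound.
\<close>
lemma measure_proj_approx_nonresonant:
  assumes e: "\<And>a. 0 \<le> e a \<and> e a \<le> 1"
    and good: "\<And>y. 0 \<le> y \<Longrightarrow> y \<le> 3 ^ (q + 5) \<Longrightarrow> 1 / 3 ^ (2 * q + 5) \<le> cmod (char_factor e y)"
    and n: "stack_level q * 3 ^ stack_level q \<le> n"
  shows "measure lebesgue (proj_approx e n) \<le> 4 / 3 ^ q"
proof -
  define K :: nat where "K = 3 ^ q"
  define R :: nat where "R = 3 ^ ((2 * q + 5) * (2 * q + 12) + 1)"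
  define d :: real where "d = 1 / 3 ^ (2 * q + 5)"
  have K: "K > 0" by (simp add: K_def)
  have m: "3 ^ (q + 5) = 243 * real K" by (simp add: K_def power_add)
  have "\<not> (\<forall>l x. l \<le> R * (q + 5) + 1 \<longrightarrow>
      card {w \<in> words l. x \<le> digit_sum e w \<and> digit_sum e w \<le> x + 1 / 3 ^ l} \<le> K)"
  proof
    assume no: "\<forall>l x. l \<le> R * (q + 5) + 1 \<longrightarrow>
      card {w \<in> words l. x \<le> digit_sum e w \<and> digit_sum e w \<le> x + 1 / 3 ^ l} \<le> K"
    have "real R * d ^ (2 * (q + 5) + 2) * 3 ^ (q + 5) \<le> 576 * real K"
      by (rule number_of_windows_le_if_no_stack[where e = e, OF e]) (use no good m in \<open>auto simp: d_def\<close>)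
    moreover have "real R * d ^ (2 * (q + 5) + 2) = 3"
      by (simp add: R_def d_def power_divide add.commute flip: power_mult)
    ultimately have "3 * 3 ^ (q + 5) \<le> 576 * real K" by (simp only:)
    then show False using K by (simp add: m)
  qed
  then obtain l x where l: "l \<le> stack_level q"
    and card: "K \<le> card {w \<in> words l. x \<le> digit_sum e w \<and> digit_sum e w \<le> x + 1 / 3 ^ l}"
    by (auto simp: stack_level_def R_def not_le dest: less_imp_le)
  define M :: nat where "M = 3 ^ stack_level q"
  have "l * M \<le> n" unfolding M_def by (rule order_trans[OF mult_right_mono[OF l] n]) simp
  then have "measure lebesgue (proj_approx e n) \<le> measure lebesgue (proj_approx e (l * M))"
    by (intro measure_mono_fmeasurable[OF proj_approx_antimono[where e = e, OF e]
          fmeasurableD[OF proj_approx_measurable] proj_approx_measurable])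
  also have "\<dots> \<le> 5 / 2 / real K + 3 / 2 * (1 - real K / 3 ^ l) ^ M"
    by (rule stack_decay[where e = e, OF e K card])
  also have "(1 - real K / 3 ^ l) ^ M \<le> 1 / real K"
  proof -
    have "K \<le> card (words l)" by (rule order_trans[OF card card_mono]) auto
    then have "real K \<le> real (3 ^ l)" unfolding of_nat_le_iff by (simp add: card_words)
    then have "(1 - real K / 3 ^ l) ^ M \<le> exp (- (real K / 3 ^ l)) ^ M"
      using exp_ge_add_one_self[of "- (real K / 3 ^ l)"] by (intro power_mono) auto
    also have "\<dots> = exp (- (real K * (real M / 3 ^ l)))" by (simp flip: exp_of_nat_mult)
    also have "\<dots> \<le> exp (- (real K * 1))"
    proof -
      have "(3::real) ^ l \<le> real M" using l by (simp add: M_def power_increasing)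
      then have "1 \<le> real M / 3 ^ l" by simp
      then have "real K * 1 \<le> real K * (real M / 3 ^ l)" by (intro mult_left_mono) auto
      then show ?thesis by simp
    qed
    also have "\<dots> = 1 / exp (real K)" by (simp add: exp_minus field_simps)
    also have "\<dots> \<le> 1 / real K"
    proof (rule divide_left_mono)
      show "real K \<le> exp (real K)" using exp_ge_add_one_self[of "real K"] by linarith
    qed (use K in auto)
    finally show ?thesis .
  qed
  finally show ?thesis by (simp add: K_def)
qed

lemma line_measure_gasket_le:
  fixes v :: "3 \<Rightarrow> real ^ 2"
  assumes s: "s > 0" "\<And>i j. i \<noteq> j \<Longrightarrow> dist (v i) (v j) = s"
    and n: "stack_level q * 3 ^ stack_level q \<le> n" and \<theta>: "\<theta> \<in> {0..pi}"
    and non: "\<theta> \<notin> resonant v (3 ^ (q + 5)) (10 / 3 ^ (2 * q + 5) * s)"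
  shows "line_measure \<theta> (line_proj \<theta> ` gasket_approx v n) \<le> ennreal (4 * s / 3 ^ q)"
proof -
  obtain i j k D e where ijk: "i \<noteq> j" "i \<noteq> k" "j \<noteq> k" and D: "0 \<le> D" "D \<le> s"
    and ek: "e i = 0" "e j = 1" "0 \<le> e k" "e k \<le> 1"
    and v: "\<forall>a. v a \<bullet> direction \<theta> = v i \<bullet> direction \<theta> + D * e a"
    by (rule direction_digits[of v s \<theta>, OF s(2)])
  have e: "0 \<le> e a \<and> e a \<le> 1" for a using mem_three_indices[OF ijk, of a] ek by auto
  have "measure lebesgue (proj_approx e n) \<le> 4 / 3 ^ q"
  proof (rule measure_proj_approx_nonresonant[where e = e, OF e _ n])
    fix y :: real assume y: "0 \<le> y" "y \<le> 3 ^ (q + 5)"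
    show "1 / 3 ^ (2 * q + 5) \<le> cmod (char_factor e y)"
    proof (rule ccontr)
      assume "\<not> ?thesis"
      moreover have "1 / 3 ^ (2 * q + 5) \<le> (1 / 100 :: real)"
      proof -
        have "(3::real) ^ 5 \<le> 3 ^ (2 * q + 5)" by (intro power_increasing) auto
        then show ?thesis by (simp add: field_simps)
      qed
      ultimately obtain a b where ab: "1 \<le> a" "a \<le> 3 ^ (q + 5)" "b \<le> a"
        "\<bar>real a * e k - real b\<bar> \<le> 10 * (1 / 3 ^ (2 * q + 5))"
        using char_factor_small_imp[OF ijk ek, of y "1 / 3 ^ (2 * q + 5)" "3 ^ (q + 5)"] y by auto
      have "(real a *\<^sub>R (v k - v i) - real b *\<^sub>R (v j - v i)) \<bullet> direction \<theta>
          = D * (real a * e k - real b)"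
        using ek by (simp add: inner_diff_left v[rule_format, of k] v[rule_format, of j] algebra_simps)
      then have "\<bar>(real a *\<^sub>R (v k - v i) - real b *\<^sub>R (v j - v i)) \<bullet> direction \<theta>\<bar>
          = \<bar>real a * e k - real b\<bar> * D"
        using D by (simp add: abs_mult mult.commute)
      also have "\<dots> \<le> (10 * (1 / 3 ^ (2 * q + 5))) * s"
        using D ab by (intro mult_mono) auto
      finally have "\<theta> \<in> resonant v (3 ^ (q + 5)) (10 / 3 ^ (2 * q + 5) * s)"
        unfolding resonant_def using ab ijk \<theta>
        by (intro UN_I[of a] UN_I[of b] UN_I[of "(i, j, k)"]) auto
      with non show False ..
    qed
  qed
  then have "s * measure lebesgue (proj_approx e n) \<le> 4 * s / 3 ^ q"
    using mult_left_mono[of _ _ s] s(1) by (metis less_imp_le mult.commute times_divide_eq_right)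
  then show ?thesis
    using line_measure_le_proj_approx[where v = v and e = e and n = n, OF D e v[rule_format]] by (meson ennreal_leI order_trans)
qed

lemma line_measure_gasket_trivial:
  fixes v :: "3 \<Rightarrow> real ^ 2"
  assumes s: "s > 0" "\<And>i j. i \<noteq> j \<Longrightarrow> dist (v i) (v j) = s"
  shows "line_measure \<theta> (line_proj \<theta> ` gasket_approx v n) \<le> ennreal (3 / 2 * s)"
proof -
  obtain i j k D e where ijk: "i \<noteq> j" "i \<noteq> k" "j \<noteq> k" and D: "0 \<le> D" "D \<le> s"
    and ek: "e i = 0" "e j = 1" "0 \<le> e k" "e k \<le> 1"
    and v: "\<forall>a. v a \<bullet> direction \<theta> = v i \<bullet> direction \<theta> + D * e a"
    by (rule direction_digits[of v s \<theta>, OF s(2)])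
  have e: "0 \<le> e a \<and> e a \<le> 1" for a using mem_three_indices[OF ijk, of a] ek by auto
  have "s * measure lebesgue (proj_approx e n) \<le> 3 / 2 * s"
    using measure_proj_approx_le[where e = e, OF e, of n] s(1) by simp
  then show ?thesis
    using line_measure_le_proj_approx[where v = v and e = e and n = n, OF D e v[rule_format]] by (meson ennreal_leI order_trans)
qed

section \<open>Averaging over directions\<close>
text \<open>
  Nonresonant directions give $4 s / 3^q$ each; the resonant ones give at most $\frac32 s$ each
  but have measure at most $4320 \pi / 3^q$.
\<close>
lemma favard_length_gasket_le:
  fixes v :: "3 \<Rightarrow> real ^ 2"
  assumes s: "s > 0" "\<And>i j. i \<noteq> j \<Longrightarrow> dist (v i) (v j) = s"
    and n: "stack_level q * 3 ^ stack_level q \<le> n"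
  shows "favard_length (gasket_approx v n) \<le> ennreal (6484 * s / 3 ^ q)"
proof -
  let ?B = "resonant v (3 ^ (q + 5)) (10 / 3 ^ (2 * q + 5) * s)"
  let ?f = "\<lambda>\<theta>. line_measure \<theta> (line_proj \<theta> ` gasket_approx v n)"
  have pt: "?f \<theta> * indicator {0..pi} \<theta>
      \<le> ennreal (4 * s / 3 ^ q) * indicator {0..pi} \<theta> + ennreal (3 / 2 * s) * indicator ?B \<theta>" for \<theta>
  proof (cases "\<theta> \<in> {0..pi}")
    case in_range: True
    show ?thesis
    proof (cases "\<theta> \<in> ?B")
      case True
      then show ?thesis using line_measure_gasket_trivial[of s v \<theta> n, OF s] in_range by (simp add: add_increasing)
    next
      case False
      then show ?thesis using line_measure_gasket_le[of s v q n \<theta>, OF s n in_range] in_range by simp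
    qed
  qed simp
  have B: "emeasure lborel ?B \<le> ennreal (4320 * pi / 3 ^ q)"
  proof -
    have "emeasure lborel ?B \<le> ennreal (432 * pi * real (3 ^ (q + 5)) * (10 / 3 ^ (2 * q + 5) * s) / s)"
      using s(1) by (intro emeasure_resonant_le s) auto
    also have "432 * pi * real (3 ^ (q + 5)) * (10 / 3 ^ (2 * q + 5) * s) / s = 4320 * pi / 3 ^ q"
      using s(1) by (simp add: power_add power_mult power2_eq_square field_simps flip: power_mult_distrib)
    finally show ?thesis .
  qed
  have "(\<integral>\<^sup>+\<theta>\<in>{0..pi}. ?f \<theta> \<partial>lborel)
      \<le> (\<integral>\<^sup>+\<theta>. ennreal (4 * s / 3 ^ q) * indicator {0..pi} \<theta> + ennreal (3 / 2 * s) * indicator ?B \<theta> \<partial>lborel)"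
    by (intro nn_integral_mono pt)
  also have "\<dots> = ennreal (4 * s / 3 ^ q) * ennreal pi + ennreal (3 / 2 * s) * emeasure lborel ?B"
    by (subst nn_integral_add) (auto simp: nn_integral_cmult_indicator)
  also have "\<dots> \<le> ennreal (4 * s / 3 ^ q) * ennreal pi + ennreal (3 / 2 * s) * ennreal (4320 * pi / 3 ^ q)"
    by (intro add_left_mono mult_left_mono B) auto
  also have "\<dots> = ennreal (4 * s / 3 ^ q * pi + 3 / 2 * s * (4320 * pi / 3 ^ q))"
    using s(1) by (simp add: ennreal_mult[symmetric] ennreal_plus[symmetric] del: ennreal_plus)
  also have "4 * s / 3 ^ q * pi + 3 / 2 * s * (4320 * pi / 3 ^ q) = 6484 * s * pi / 3 ^ q"
    by (simp add: field_simps)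
  finally have "favard_length (gasket_approx v n) \<le> ennreal (1 / pi) * ennreal (6484 * s * pi / 3 ^ q)"
    unfolding favard_length_def by (rule mult_left_mono) auto
  also have "\<dots> = ennreal (6484 * s / 3 ^ q)"
    using s(1) by (simp add: ennreal_mult[symmetric])
  finally show ?thesis .
qed

lemma favard_length_gasket_trivial:
  fixes v :: "3 \<Rightarrow> real ^ 2"
  assumes s: "s > 0" "\<And>i j. i \<noteq> j \<Longrightarrow> dist (v i) (v j) = s"
  shows "favard_length (gasket_approx v n) \<le> ennreal (3 / 2 * s)"
proof -
  have "(\<integral>\<^sup>+\<theta>\<in>{0..pi}. line_measure \<theta> (line_proj \<theta> ` gasket_approx v n) \<partial>lborel)
      \<le> (\<integral>\<^sup>+\<theta>\<in>{0..pi}. ennreal (3 / 2 * s) \<partial>lborel)"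
    by (intro nn_integral_mono mult_right_mono line_measure_gasket_trivial s) auto
  also have "\<dots> = ennreal (3 / 2 * s) * ennreal pi"
    by (subst nn_integral_cmult_indicator) auto
  finally have "favard_length (gasket_approx v n) \<le> ennreal (1 / pi) * (ennreal (3 / 2 * s) * ennreal pi)"
    unfolding favard_length_def by (rule mult_left_mono) auto
  also have "\<dots> = ennreal (3 / 2 * s)"
    using s(1) by (simp add: ennreal_mult[symmetric])
  finally show ?thesis .
qed

text \<open>
  The level is $e^{O((q+1)^2)}$, since the exponent of 3 in it is quadratic in \<open>q\<close>; one further
  exponential comes from the number of repetitions in \<open>stack_decay\<close>.
\<close>
lemma stack_level_growth: "real (stack_level q * 3 ^ stack_level q) \<le> exp (exp (200 * (real q + 1)^2))"
proof -
  have e2: "(3::real) \<le> exp 2" using exp_ge_add_one_self[of "2::real"] by simp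
  define p where "p = (2 * q + 5) * (2 * q + 12) + 1"
  have le3: "real k + 1 \<le> 3 ^ k" for k :: nat
    by (induction k) auto
  have "real (stack_level q) = 3 ^ p * real (q + 5) + 1" by (simp add: stack_level_def p_def)
  also have "\<dots> \<le> 3 ^ p * real (q + 5) + 3 ^ p * 1" by simp
  also have "\<dots> = 3 ^ p * (real (q + 5) + 1)" by (simp add: distrib_left)
  also have "\<dots> \<le> 3 ^ p * 3 ^ (q + 5)" by (intro mult_left_mono le3) auto
  finally have "real (stack_level q) \<le> 3 ^ p * 3 ^ (q + 5)" .
  then have "real (stack_level q) * 4 \<le> 3 ^ (p + q + 8)"
    by (simp add: power_add)
  also have "\<dots> \<le> (exp 2) ^ (p + q + 8)" using e2 by (intro power_mono) auto
  also have "\<dots> = exp (2 * real (p + q + 8))" by (simp flip: exp_of_nat_mult add: mult.commute)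
  also have "\<dots> \<le> exp (200 * (real q + 1)^2)"
    by (simp add: p_def power2_eq_square algebra_simps)
  finally have 1: "4 * real (stack_level q) \<le> exp (200 * (real q + 1)^2)" by simp
  have "real (stack_level q * 3 ^ stack_level q) \<le> 3 ^ stack_level q * 3 ^ stack_level q"
    using le3[of "stack_level q"] by (simp add: mult_right_mono)
  also have "\<dots> = 9 ^ stack_level q" by (simp flip: power_mult_distrib)
  also have "\<dots> \<le> (exp 4) ^ stack_level q"
    using mult_mono[OF e2 e2] by (intro power_mono) (auto simp flip: exp_add)
  also have "\<dots> = exp (4 * real (stack_level q))" by (simp flip: exp_of_nat_mult add: mult.commute)
  also have "\<dots> \<le> exp (exp (200 * (real q + 1)^2))" using 1 by simp
  finally show ?thesis .
qed

text \<open>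
  With $y = c \sqrt{\log\log n}$ and $200\,c^2 = 1$, the largest usable \<open>q\<close> is about $y - 1$. For
  $y < 1$ there is no such \<open>q\<close>, and the trivial bound suffices.
\<close>
theorem theorem1:
  fixes v :: "3 \<Rightarrow> real ^ 2"
  assumes "equilateral v"
  shows "\<exists>C c :: real. C > 0 \<and> c > 0 \<and>
    (\<forall>n::nat. n \<ge> 3 \<longrightarrow>
      favard_length (gasket_approx v n) \<le> ennreal (C * exp (- c * sqrt (ln (ln (real n))))))"
proof -
  obtain s where s: "s > 0" "\<And>i j. i \<noteq> j \<Longrightarrow> dist (v i) (v j) = s"
    using assms unfolding equilateral_def by blast
  define c :: real where "c = sqrt (1 / 200)"
  define C where "C = 6484 * s * exp 2"
  have "favard_length (gasket_approx v n) \<le> ennreal (C * exp (- c * sqrt (ln (ln (real n)))))" if "n \<ge> 3" for n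
  proof -
    have "1 < ln (3::real)" using e_less_272 ln_less_cancel_iff[of "exp 1" 3] by simp
    also have "ln 3 \<le> ln (real n)" using that by simp
    finally have lnn: "1 < ln (real n)" .
    define x where "x = ln (ln (real n))"
    have x: "x > 0" using lnn by (simp add: x_def)
    define y where "y = c * sqrt x"
    have y: "y \<ge> 0" "200 * y^2 = x" using x by (auto simp: y_def c_def power_mult_distrib)
    show ?thesis
    proof (cases "y < 1")
      case True
      have "3 / 2 * s \<le> 6484 * s" using s(1) by simp
      also have "\<dots> \<le> 6484 * s * (exp 2 * exp (- y))"
      proof -
        have "1 \<le> exp (2 - y)" using True by simp
        then show ?thesis using s(1) by (simp add: exp_diff exp_minus field_simps)
      qed
      finally have "3 / 2 * s \<le> C * exp (- c * sqrt x)" by (simp add: C_def y_def mult_ac)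
      then show ?thesis
        unfolding x_def[symmetric] by (intro order_trans[OF favard_length_gasket_trivial[of s v, OF s] ennreal_leI])
    next
      case False
      define q where "q = nat (\<lfloor>y\<rfloor> - 1)"
      have q: "real q + 1 \<le> y" "y \<le> real q + 2" using False by (auto simp: q_def) linarith+
      have "200 * (real q + 1)^2 \<le> x" using q(1) unfolding y(2)[symmetric] by (intro mult_left_mono power_mono) auto
      then have "exp (exp (200 * (real q + 1)^2)) \<le> exp (exp x)" by simp
      also have "\<dots> = real n" using that lnn by (simp add: x_def)
      finally have "real (stack_level q * 3 ^ stack_level q) \<le> real n" using stack_level_growth[of q] by linarith
      then have "stack_level q * 3 ^ stack_level q \<le> n" by (simp only: of_nat_le_iff)
      then have "favard_length (gasket_approx v n) \<le> ennreal (6484 * s / 3 ^ q)"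
        using favard_length_gasket_le[of s v q n, OF s] by blast
      also have "\<dots> \<le> ennreal (C * exp (- c * sqrt x))"
      proof (rule ennreal_leI)
        have "exp (real q) = exp 1 ^ q" by (simp flip: exp_of_nat_mult)
        also have "\<dots> \<le> 3 ^ q" using exp_le by (intro power_mono) auto
        finally have "6484 * s / 3 ^ q \<le> 6484 * s / exp (real q)" using s(1) by (intro divide_left_mono) auto
        also have "\<dots> = 6484 * s * exp (- real q)" by (simp add: exp_minus field_simps)
        also have "\<dots> \<le> 6484 * s * exp (2 - y)" using q s(1) by simp
        also have "\<dots> = C * exp (- c * sqrt x)" by (simp add: C_def y_def exp_diff exp_minus field_simps)
        finally show "6484 * s / 3 ^ q \<le> C * exp (- c * sqrt x)" .
      qed
      finally show ?thesis unfolding x_def .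
    qed
  qed
  moreover have "C > 0" "c > 0" using s(1) by (auto simp: C_def c_def)
  ultimately show ?thesis by blast
qed

end
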